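(* Suppose that $\Phi(z)=F_0[f](z)+H_0[h](z)-G[g](z)$ for $z\in\mathbb{D}$, where $h\in C(\mathbb{T})$, $g\in C(\overline{\mathbb{D}})$ (complex-valued) and $f:\mathbb{T}\to\mathbb{C}$ satisfies the Lipschitz condition $$|f(e^{i\theta})-f(e^{i\varphi})|\le L|e^{i\theta}-e^{i\varphi}|\quad\text{for all }\theta,\varphi,$$ where $L$ is a constant. Then for all $z_1,z_2\in\mathbb{D}$, $$P\Big(\frac{Q}{P^2}-2\Big)|z_1-z_2|\le|\Phi(z_1)-\Phi(z_2)|\le P|z_1-z_2|,$$ where $$P=\frac{220}{3}L+4\|h\|_{\infty,\mathbb{T}}+\frac{23}{3}\|g\|_\infty,\qquad \|h\|_{\infty,\mathbb{T}}=\sup_{z\in\mathbb{T}}|h(z)|,\qquad \|g\|_\infty=\sup_{z\in\mathbb{D}}|g(z)|,$$ $$A=\left|\frac1{4\pi}\int_0^{2\pi}e^{-i\theta}\big(3f(e^{i\theta})+h(e^{i\theta})\big)\,d\theta-\int_{\mathbb{D}}\overline\zeta\,(\log|\zeta|^2+1-|\zeta|^2)\,g(\zeta)\,dA(\zeta)\right|^2,$$ $$B=\left|\frac1{4\pi}\int_0^{2\pi}e^{i\theta}\big(3f(e^{i\theta})+h(e^{i\theta})\big)\,d\theta-\int_{\mathbb{D}}\zeta\,(\log|\zeta|^2+1-|\zeta|^2)\,g(\zeta)\,dA(\zeta)\right|^2,$$ and $Q=A-B$.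
   Context: $\mathbb{D}=\{z\in\mathbb{C}:|z|<1\}$, $\mathbb{T}=\partial\mathbb{D}$, and $dA=\frac1\pi\,dx\,dy$ is normalized area measure on $\mathbb{D}$. Kernels on $\mathbb{D}$: $$H_0(z)=\frac12\frac{(1-|z|^2)^2}{|1-z|^2},\qquad F_0(z)=H_0(z)+\frac12\frac{(1-|z|^2)^3}{|1-z|^4},$$ $$F_0[f](z)=\frac1{2\pi}\int_0^{2\pi}F_0(ze^{-i\theta})f(e^{i\theta})\,d\theta,\qquad H_0[h](z)=\frac1{2\pi}\int_0^{2\pi}H_0(ze^{-i\theta})h(e^{i\theta})\,d\theta.$$ For $z,\zeta\in\mathbb{D}$, $z\ne\zeta$, $$G(z,\zeta)=|z-\zeta|^2\log\left|\frac{1-\overline\zeta z}{z-\zeta}\right|^2-(1-|z|^2)(1-|\zeta|^2)$$ (extended continuously to $z=\zeta$), and $G[g](z)=\int_{\mathbb{D}}G(z,\zeta)g(\zeta)\,dA(\zeta)$. *)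

theory Defs
  imports "HOL-Analysis.Analysis"
begin

definition H0 :: "complex \<Rightarrow> real" where
  "H0 z = 1/2 * (1 - (cmod z)\<^sup>2)\<^sup>2 / (cmod (1 - z))\<^sup>2"

definition F0 :: "complex \<Rightarrow> real" where
  "F0 z = H0 z + 1/2 * (1 - (cmod z)\<^sup>2)^3 / (cmod (1 - z))^4"

text \<open>
  A boundary function on the unit circle is a function \<^typ>\<open>complex \<Rightarrow> complex\<close> of which only
  the values at the points \<^term>\<open>cis \<theta>\<close> are used.
\<close>

definition circle_conv :: "(complex \<Rightarrow> real) \<Rightarrow> (complex \<Rightarrow> complex) \<Rightarrow> complex \<Rightarrow> complex" where
  "circle_conv K u z =
     complex_of_real (1 / (2 * pi)) * integral {0..2*pi} (\<lambda>\<theta>. complex_of_real (K (z * cis (-\<theta>))) * u (cis \<theta>))"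

definition F0_op :: "(complex \<Rightarrow> complex) \<Rightarrow> complex \<Rightarrow> complex" where
  "F0_op f = circle_conv F0 f"

definition H0_op :: "(complex \<Rightarrow> complex) \<Rightarrow> complex \<Rightarrow> complex" where
  "H0_op h = circle_conv H0 h"

text \<open>Integration over the unit disc against \<open>dA = dx dy / \<pi>\<close>.\<close>

definition disc_integral :: "(complex \<Rightarrow> complex) \<Rightarrow> complex" where
  "disc_integral u = complex_of_real (1 / pi) * (LINT \<zeta>:ball 0 1|lborel. u \<zeta>)"

text \<open>
  On the diagonal the first summand is 0 because of the factor \<^term>\<open>(cmod (z - \<zeta>))\<^sup>2\<close>,
  so the formula already gives the continuous extension to \<open>z = \<zeta>\<close>.
\<close>

definition Green :: "complex \<Rightarrow> complex \<Rightarrow> real" where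
  "Green z \<zeta> =
     (cmod (z - \<zeta>))\<^sup>2 * ln ((cmod ((1 - cnj \<zeta> * z) / (z - \<zeta>)))\<^sup>2)
     - (1 - (cmod z)\<^sup>2) * (1 - (cmod \<zeta>)\<^sup>2)"

definition Green_op :: "(complex \<Rightarrow> complex) \<Rightarrow> complex \<Rightarrow> complex" where
  "Green_op g z = disc_integral (\<lambda>\<zeta>. complex_of_real (Green z \<zeta>) * g \<zeta>)"

end

theory Submission
  imports Defs
begin

text \<open>
  Upper bound: the three operators are Lipschitz on the disc with constants \<open>37 L\<close>, \<open>4 \<parallel>h\<parallel>\<close>
  and \<open>23/3 \<parallel>g\<parallel>\<close>. Write \<open>N = 1 - |w|\<^sup>2\<close> and \<open>d = |1 - w|\<close>, so that \<open>N \<le> 2 d\<close>. The gradient of \<open>H0\<close>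
  is at most four times the Poisson kernel \<open>N / d\<^sup>2\<close>, whose circular mean is 1. Since \<open>F0_op\<close> reproduces
  constants, \<open>f\<close> may be replaced by \<open>f - f (z / |z|)\<close>, which is \<open>O(d)\<close>; this tames the
  gradient \<open>O(N / d\<^sup>2 + N\<^sup>2 / d^4)\<close> of \<open>F0\<close>, because the circular mean of \<open>N^3 / d^4\<close> is \<open>1 + |z|\<^sup>2\<close>.
  For the Green potential the gradient of \<open>Green\<close> in \<open>z\<close> is even bounded pointwise, by
  \<open>2 (2 (X - Y) + (1 - |\<zeta>|\<^sup>2) (1 + |z|))\<close> with \<open>X = |1 - cnj \<zeta> z|\<close> and \<open>Y = |z - \<zeta>|\<close>.

  Lower bound: direct estimates of the integrals give \<open>A \<le> P\<^sup>2\<close>, so the left-hand side is never positive.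
\<close>

subsection \<open>Circular means of the kernels\<close>

lemma rotate_in_disc: "z \<in> ball 0 1 \<Longrightarrow> z * cis t \<in> ball 0 1"
  by (simp add: norm_mult)

text \<open>The right-hand sides are built from \<open>1\<close> and the real parts of
  \<open>p / (1 - p)\<close> and \<open>p / (1 - p)\<^sup>2\<close>, holomorphic and zero at the
  origin, with coefficients depending only on \<open>cmod p\<close>. On a circle about 0 the means
  can therefore be read off.\<close>

lemma Poisson_kernel_eq_Re:
  assumes "p \<in> ball (0::complex) 1"
  shows "(1 - (cmod p)\<^sup>2) / (cmod (1 - p))\<^sup>2 = 1 + 2 * Re (p / (1 - p))"
    and "(1 - (cmod p)\<^sup>2)^3 / (cmod (1 - p))^4
      = (1 + (cmod p)\<^sup>2) * ((1 - (cmod p)\<^sup>2) / (cmod (1 - p))\<^sup>2)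
        + 2 * (1 - (cmod p)\<^sup>2) * Re (p / (1 - p)\<^sup>2)"
proof -
  obtain x y where p: "p = Complex x y" by (cases p)
  define D where "D = (1 - x)\<^sup>2 + y\<^sup>2"
  have ne: "1 - p \<noteq> 0" using assms by auto
  have D: "(cmod (1 - p))\<^sup>2 = D" by (simp add: p D_def cmod_power2)
  have D0: "D \<noteq> 0" using ne D by auto
  have D4: "(cmod (1 - p))^4 = D\<^sup>2"
    using D by (metis power2_eq_square power4_eq_xxxx mult.assoc)
  have N: "(cmod p)\<^sup>2 = x\<^sup>2 + y\<^sup>2" by (simp add: p cmod_power2)
  have "p / (1 - p) = p * cnj (1 - p) / of_real D"
    using complex_div_cnj[of p "1 - p"] D by simp
  then have q: "Re (p / (1 - p)) = (x * (1 - x) - y\<^sup>2) / D"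
    by (simp add: p power2_eq_square)
  then show "(1 - (cmod p)\<^sup>2) / (cmod (1 - p))\<^sup>2 = 1 + 2 * Re (p / (1 - p))"
    unfolding D N q using D0 by (simp add: field_simps) (simp add: D_def power2_eq_square algebra_simps)
  have "p / (1 - p)\<^sup>2 = p * cnj ((1 - p)\<^sup>2) / of_real (D\<^sup>2)"
    using complex_div_cnj[of p "(1 - p)\<^sup>2"] D4 by (simp add: norm_power power_mult[symmetric])
  then have q2: "Re (p / (1 - p)\<^sup>2) = (x * ((1-x)\<^sup>2 - y\<^sup>2) - 2 * (1 - x) * y\<^sup>2) / D\<^sup>2"
    by (simp add: p power2_eq_square algebra_simps flip: of_real_mult)
  show "(1 - (cmod p)\<^sup>2)^3 / (cmod (1 - p))^4
      = (1 + (cmod p)\<^sup>2) * ((1 - (cmod p)\<^sup>2) / (cmod (1 - p))\<^sup>2)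
        + 2 * (1 - (cmod p)\<^sup>2) * Re (p / (1 - p)\<^sup>2)"
    unfolding D N D4 q2 using D0 
    by (simp add: field_simps)
      (simp add: D_def power2_eq_square power3_eq_cube power4_eq_xxxx algebra_simps)
qed

lemma rotate_has_vector_derivative:
  "((\<lambda>\<theta>. z * cis (-\<theta>)) has_vector_derivative (-\<i> * (z * cis (-\<theta>)))) (at \<theta> within S)"
proof -
  have "((\<lambda>w. z * exp (-\<i> * w)) has_field_derivative (-\<i> * (z * cis (-\<theta>)))) (at (of_real \<theta>))"
    by (auto intro!: derivative_eq_intros simp: cis_conv_exp)
  from has_vector_derivative_real_field[OF this] show ?thesis
    by (simp add: cis_conv_exp)
qed

text \<open>Each integrand has an explicit antiderivative that depends on \<theta> only through
  \<open>z * cis (-\<theta>)\<close>, hence takes the same value at both ends of the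
  interval.\<close>

lemma circle_integral_eq_0:
  assumes z: "z \<in> ball (0::complex) 1"
  shows "((\<lambda>\<theta>. z * cis (-\<theta>) / (1 - z * cis (-\<theta>))) has_integral 0) {0..2*pi}"
    and "((\<lambda>\<theta>. z * cis (-\<theta>) / (1 - z * cis (-\<theta>))\<^sup>2) has_integral 0) {0..2*pi}"
proof -
  let ?p = "\<lambda>\<theta>. z * cis (-\<theta>)"
  note dp = rotate_has_vector_derivative[of z]
  have in_ball: "cmod (?p \<theta>) < 1" for \<theta> using z by (simp add: norm_mult)
  \<comment> \<open>The curve \<open>1 - ?p \<theta>\<close> stays in the right half-plane, so the
    principal branch \<open>Ln\<close> is holomorphic along it.\<close>
  have Re: "0 < Re (1 - ?p \<theta>)" for \<theta>
    using in_ball[of \<theta>] complex_Re_le_cmod[of "?p \<theta>"] by simp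
  then have nonpos: "1 - ?p \<theta> \<notin> \<real>\<^sub>\<le>\<^sub>0" for \<theta>
    using complex_nonpos_Reals_iff by (metis less_le_not_le)
  have ne: "1 - ?p \<theta> \<noteq> 0" for \<theta> using Re[of \<theta>] by force
  have "((\<lambda>\<theta>. - \<i> * Ln (1 - ?p \<theta>)) has_vector_derivative (?p \<theta> / (1 - ?p \<theta>)))
          (at \<theta> within {0..2*pi})" for \<theta>
  proof -
    have "((\<lambda>w. - \<i> * Ln (1 - w)) has_field_derivative (\<i> / (1 - ?p \<theta>))) (at (?p \<theta>))"
      using nonpos[of \<theta>] ne[of \<theta>] by (auto intro!: derivative_eq_intros simp: field_simps)
    from field_vector_diff_chain_within[OF dp has_field_derivative_at_within[OF this]]
    moreover have "(- \<i> * ?p \<theta>) * (\<i> / (1 - ?p \<theta>)) = ?p \<theta> / (1 - ?p \<theta>)"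
      by (simp add: mult_ac)
    ultimately show ?thesis by (simp only: o_def)
  qed
  from fundamental_theorem_of_calculus[OF _ this]
  show "((\<lambda>\<theta>. ?p \<theta> / (1 - ?p \<theta>)) has_integral 0) {0..2*pi}" by (simp add: cis_cnj[symmetric])
  have "((\<lambda>\<theta>. \<i> / (1 - ?p \<theta>)) has_vector_derivative (?p \<theta> / (1 - ?p \<theta>)\<^sup>2))
          (at \<theta> within {0..2*pi})" for \<theta>
  proof -
    have "((\<lambda>w. \<i> / (1 - w)) has_field_derivative (\<i> / (1 - ?p \<theta>)\<^sup>2)) (at (?p \<theta>))"
      using ne[of \<theta>] by (auto intro!: derivative_eq_intros simp: field_simps power2_eq_square)
    from field_vector_diff_chain_within[OF dp has_field_derivative_at_within[OF this]]
    moreover have "(- \<i> * ?p \<theta>) * (\<i> / (1 - ?p \<theta>)\<^sup>2) = ?p \<theta> / (1 - ?p \<theta>)\<^sup>2"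
      by (simp add: mult_ac)
    ultimately show ?thesis by (simp only: o_def)
  qed
  from fundamental_theorem_of_calculus[OF _ this]
  show "((\<lambda>\<theta>. ?p \<theta> / (1 - ?p \<theta>)\<^sup>2) has_integral 0) {0..2*pi}" by (simp add: cis_cnj[symmetric])
qed

lemma circle_integral_Poisson:
  assumes z: "z \<in> ball (0::complex) 1"
  shows "((\<lambda>\<theta>. (1 - (cmod z)\<^sup>2) / (cmod (1 - z * cis (-\<theta>)))\<^sup>2) has_integral 2*pi) {0..2*pi}"
    and "((\<lambda>\<theta>. (1 - (cmod z)\<^sup>2)^3 / (cmod (1 - z * cis (-\<theta>)))^4)
            has_integral 2*pi * (1 + (cmod z)\<^sup>2)) {0..2*pi}"
proof -
  let ?p = "\<lambda>\<theta>. z * cis (-\<theta>)"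
  have n: "cmod (z * cis \<theta>) = cmod z" for \<theta> by (simp add: norm_mult)
  note id = Poisson_kernel_eq_Re[OF rotate_in_disc[OF z], unfolded n]
  have i: "((\<lambda>\<theta>. Re (?p \<theta> / (1 - ?p \<theta>))) has_integral 0) {0..2*pi}"
    "((\<lambda>\<theta>. Re (?p \<theta> / (1 - ?p \<theta>)\<^sup>2)) has_integral 0) {0..2*pi}"
    using has_integral_linear[OF circle_integral_eq_0(1)[OF z] bounded_linear_Re]
      has_integral_linear[OF circle_integral_eq_0(2)[OF z] bounded_linear_Re]
    by (simp_all add: o_def)
  have one: "((\<lambda>\<theta>. 1::real) has_integral 2*pi) {0..2*pi}"
    using has_integral_const_real[of "1::real" 0 "2*pi"] by simp
  show 1: "((\<lambda>\<theta>. (1 - (cmod z)\<^sup>2) / (cmod (1 - ?p \<theta>))\<^sup>2) has_integral 2*pi) {0..2*pi}"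
    using has_integral_add[OF one has_integral_mult_right[OF i(1), of 2]]
    by (simp only: id(1)) simp
  show "((\<lambda>\<theta>. (1 - (cmod z)\<^sup>2)^3 / (cmod (1 - ?p \<theta>))^4)
            has_integral 2*pi * (1 + (cmod z)\<^sup>2)) {0..2*pi}"
    using has_integral_add[OF has_integral_mult_right[OF 1, of "1 + (cmod z)\<^sup>2"] 
        has_integral_mult_right[OF i(2), of "2 * (1 - (cmod z)\<^sup>2)"]]
    by (simp only: id(2)) (simp add: mult_ac)
qed

text \<open>\<open>F0\<close> is \<open>N / 2\<close> times the Poisson kernel plus half of
  \<open>N^3 / d^4\<close>, so its mean is
  \<open>(1 - |z|^2) / 2 + (1 + |z|^2) / 2 = 1\<close>.\<close>

lemma F0_op_const:
  assumes z: "z \<in> ball 0 1"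
  shows "F0_op (\<lambda>_. c) z = c"
proof -
  let ?N = "1 - (cmod z)\<^sup>2"
  have n: "cmod (z * cis (-\<theta>)) = cmod z" for \<theta> by (simp add: norm_mult)
  have "((\<lambda>\<theta>. ?N / 2 * (?N / (cmod (1 - z * cis (-\<theta>)))\<^sup>2)
              + 1/2 * (?N^3 / (cmod (1 - z * cis (-\<theta>)))^4)) has_integral 
         ?N / 2 * (2*pi) + 1/2 * (2*pi * (1 + (cmod z)\<^sup>2))) {0..2*pi}"
    by (intro has_integral_add has_integral_mult_right circle_integral_Poisson z)
  then have "((\<lambda>\<theta>. F0 (z * cis (-\<theta>))) has_integral 2*pi) {0..2*pi}"
    by (simp add: F0_def H0_def n power2_eq_square field_simps)
  from has_integral_mult_left[OF has_integral_of_real[OF this], of c] 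
  have "integral {0..2*pi} (\<lambda>\<theta>. of_real (F0 (z * cis (-\<theta>))) * c) = of_real (2*pi) * c"
    by (rule integral_unique)
  then show ?thesis unfolding F0_op_def circle_conv_def
    by (simp del: integral_mult_left)
qed

subsection \<open>Boundary operators\<close>

text \<open>The derivative of \<open>H0\<close> at \<open>w\<close> in direction \<open>v\<close>,
  in closed form so that its joint continuity and its size can be read off.\<close>

definition DH0 :: "complex \<Rightarrow> complex \<Rightarrow> real" where
  "DH0 w v = - 2 * (1 - (cmod w)\<^sup>2) * (w \<bullet> v) / (cmod (1 - w))\<^sup>2
     + (1 - (cmod w)\<^sup>2)\<^sup>2 * ((1 - w) \<bullet> v) / (cmod (1 - w))^4"

definition DF0 :: "complex \<Rightarrow> complex \<Rightarrow> real" where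
  "DF0 w v = DH0 w v - 3 * (1 - (cmod w)\<^sup>2)\<^sup>2 * (w \<bullet> v) / (cmod (1 - w))^4
     + 2 * (1 - (cmod w)\<^sup>2)^3 * ((1 - w) \<bullet> v) / (cmod (1 - w))^6"

text \<open>Even powers of the modulus are polynomials in an inner product, which the derivative
  rules handle directly.\<close>

lemma cmod_powers_inner:
  "(cmod w)\<^sup>2 = w \<bullet> w" "(cmod w)^4 = (w \<bullet> w)\<^sup>2" "(cmod w)^6 = (w \<bullet> w)^3"
  by (simp_all add: power_mult[symmetric] flip: power2_norm_eq_inner)

lemma H0_has_derivative:
  assumes w: "w \<in> ball 0 1"
  shows "(H0 has_derivative DH0 w) (at w)"
proof -
  have ne: "(1 - w) \<bullet> (1 - w) \<noteq> 0" using w by auto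
  \<comment> \<open>Naming the denominator keeps it atomic, so that clearing fractions leaves a
    polynomial identity.\<close>
  define D where "D = (1 - w) \<bullet> (1 - w)"
  have "((\<lambda>w. 1/2 * (1 - w \<bullet> w)\<^sup>2 / ((1 - w) \<bullet> (1 - w))) has_derivative DH0 w) (at w)"
    apply (rule derivative_eq_intros ne refl)+
    unfolding DH0_def cmod_powers_inner D_def[symmetric] using ne[folded D_def]
    by (simp add: fun_eq_iff inner_commute field_simps power2_eq_square)
  then show ?thesis by (simp add: H0_def[abs_def] cmod_powers_inner)
qed

lemma F0_has_derivative:
  assumes w: "w \<in> ball 0 1"
  shows "(F0 has_derivative DF0 w) (at w)"
proof -
  have ne: "(1 - w) \<bullet> (1 - w) \<noteq> 0" using w by auto
  define D where "D = (1 - w) \<bullet> (1 - w)"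
  have ne2: "((1 - w) \<bullet> (1 - w))\<^sup>2 \<noteq> 0" using ne by simp
  have "((\<lambda>w. H0 w + 1/2 * (1 - w \<bullet> w)^3 / ((1 - w) \<bullet> (1 - w))\<^sup>2) has_derivative DF0 w) (at w)"
    apply (rule derivative_eq_intros ne2 refl H0_has_derivative w)+
    unfolding DF0_def cmod_powers_inner D_def[symmetric] using ne[folded D_def]
    by (simp add: fun_eq_iff inner_commute field_simps power2_eq_square power3_eq_cube)
  then show ?thesis by (simp add: F0_def[abs_def] cmod_powers_inner)
qed

text \<open>Joint continuity is what the Leibniz rule asks for: in the circular integral both the
  base point and the direction rotate with \<theta>.\<close>

lemma continuous_on_DH0: "continuous_on (ball 0 1 \<times> UNIV) (\<lambda>(w, v). DH0 w v)"
  and continuous_on_DF0: "continuous_on (ball 0 1 \<times> UNIV) (\<lambda>(w, v). DF0 w v)"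
  unfolding DF0_def DH0_def split_beta
  by (intro continuous_intros; force)+

text \<open>Differentiation under the integral sign along a segment. The moving point enters through
  the kernel alone, so the chain rule for \<open>K\<close> supplies the derivative of the
  integrand.\<close>

lemma circle_conv_has_vector_derivative:
  assumes K: "\<And>w. w \<in> ball 0 1 \<Longrightarrow> (K has_derivative DK w) (at w)"
    and DK: "continuous_on (ball 0 1 \<times> UNIV) (\<lambda>(w, v). DK w v)"
    and u: "continuous_on {0..2*pi} (\<lambda>\<theta>. u (cis \<theta>))"
    and seg: "\<And>t. t \<in> {0..1} \<Longrightarrow> z + t *\<^sub>R v \<in> ball 0 1" and s: "s \<in> {0..1}"
  shows "((\<lambda>t. circle_conv K u (z + t *\<^sub>R v)) has_vector_derivative
    complex_of_real (1 / (2 * pi)) * integral {0..2*pi}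
      (\<lambda>\<theta>. complex_of_real (DK ((z + s *\<^sub>R v) * cis (-\<theta>)) (v * cis (-\<theta>))) * u (cis \<theta>)))
    (at s within {0..1})"
  unfolding circle_conv_def
proof (rule has_vector_derivative_mult_right)
  let ?w = "\<lambda>t \<theta>. (z + t *\<^sub>R v) * cis (-\<theta>)"
  have inb: "?w t \<theta> \<in> ball 0 1" if "t \<in> {0..1}" for t \<theta>
    using seg[OF that] by (simp add: norm_mult)
  have K_cont: "continuous_on (ball 0 1) K"
    using K by (meson continuous_at_imp_continuous_on has_derivative_continuous)
  show "((\<lambda>t. integral {0..2*pi} (\<lambda>\<theta>. complex_of_real (K (?w t \<theta>)) * u (cis \<theta>)))
     has_vector_derivative integral {0..2*pi}
      (\<lambda>\<theta>. complex_of_real (DK (?w s \<theta>) (v * cis (-\<theta>))) * u (cis \<theta>))) (at s within {0..1})"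
  proof (rule leibniz_rule_vector_derivative[where U = "{0..1}" and a = 0 and b = "2*pi"
        and f = "\<lambda>t \<theta>. complex_of_real (K (?w t \<theta>)) * u (cis \<theta>)"
        and fx = "\<lambda>t \<theta>. complex_of_real (DK (?w t \<theta>) (v * cis (-\<theta>))) * u (cis \<theta>)", unfolded cbox_interval])
    fix t \<theta> :: real assume t: "t \<in> {0..1}"
    have 1: "((\<lambda>t. ?w t \<theta>) has_vector_derivative v * cis (-\<theta>)) (at t within {0..1})"
      by (auto intro!: derivative_eq_intros simp: has_vector_derivative_def)
    have K': "(K has_derivative DK (?w t \<theta>)) (at (?w t \<theta>) within (\<lambda>t. ?w t \<theta>) ` {0..1})"
      using K[OF inb[OF t]] by (rule has_derivative_at_withinI)
    have "linear (DK (?w t \<theta>))"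
      using K[OF inb[OF t]] has_derivative_linear by blast
    then have 2: "((\<lambda>t. K (?w t \<theta>)) has_vector_derivative DK (?w t \<theta>) (v * cis (-\<theta>))) (at t within {0..1})"
      using has_derivative_in_compose[OF 1[unfolded has_vector_derivative_def] K']
      by (simp only: has_vector_derivative_def linear_cmul)
    show "((\<lambda>t. complex_of_real (K (?w t \<theta>)) * u (cis \<theta>)) has_vector_derivative
       complex_of_real (DK (?w t \<theta>) (v * cis (-\<theta>))) * u (cis \<theta>)) (at t within {0..1})"
      by (intro has_vector_derivative_mult_left has_vector_derivative_of_real
          2[folded has_real_derivative_iff_has_vector_derivative])
  next
    fix t :: real assume t: "t \<in> {0..1}"
    show "(\<lambda>\<theta>. complex_of_real (K (?w t \<theta>)) * u (cis \<theta>)) integrable_on {0..2*pi}"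
      by (intro integrable_continuous_interval continuous_intros u
          continuous_on_compose2[OF K_cont]) (use inb[OF t] in \<open>auto simp: cis_conv_exp intro!: continuous_intros\<close>)
  next
    show "continuous_on ({0..1} \<times> {0..2*pi})
       (\<lambda>(t, \<theta>). complex_of_real (DK (?w t \<theta>) (v * cis (-\<theta>))) * u (cis \<theta>))"
      unfolding split_beta
      by (intro continuous_intros continuous_on_compose2[OF u]
          continuous_on_compose2[OF DK[unfolded split_beta], of _ "\<lambda>x. (?w (fst x) (snd x), v * cis (- snd x))", simplified])
         (use inb in \<open>auto simp: cis_conv_exp intro!: continuous_intros\<close>)
  qed (use s in auto)
qed

section \<open>Pointwise gradient bounds for the boundary kernels\<close>

lemma cmod_one_minus_bounds:
  assumes w: "w \<in> ball (0::complex) 1"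
  shows "0 < cmod (1 - w)" "0 < 1 - (cmod w)\<^sup>2" "1 - (cmod w)\<^sup>2 \<le> 2 * cmod (1 - w)"
proof -
  have r: "cmod w < 1" using w by simp
  have "1 - cmod w \<le> cmod (1 - w)" using norm_triangle_ineq2[of 1 w] by simp
  \<comment> \<open>The left side is \<open>1 - |w|^2\<close>. The resulting
    \<open>N \<le> 2 * d\<close> later trades a factor \<open>N\<close> for a factor
    \<open>2 * d\<close>.\<close>
  then have "(1 - cmod w) * (1 + cmod w) \<le> cmod (1 - w) * 2"
    using r by (intro mult_mono) auto
  then show "1 - (cmod w)\<^sup>2 \<le> 2 * cmod (1 - w)" by (simp add: power2_eq_square algebra_simps)
  show "0 < 1 - (cmod w)\<^sup>2" using r by (simp add: power_less_one_iff)
  show "0 < cmod (1 - w)" using w by auto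
qed

text \<open>By Cauchy-Schwarz the first term contributes \<open>2 * N / d\<^sup>2\<close>. In the
  second, one of the two factors \<open>N\<close> is replaced by \<open>2 * d\<close>, which gives
  \<open>2 * N / d\<^sup>2\<close> again.\<close>

lemma abs_DH0_le:
  assumes w: "w \<in> ball 0 1"
  shows "\<bar>DH0 w v\<bar> \<le> 4 * ((1 - (cmod w)\<^sup>2) / (cmod (1 - w))\<^sup>2) * cmod v"
proof -
  define d N where "d = cmod (1 - w)" and "N = 1 - (cmod w)\<^sup>2"
  note pos = cmod_one_minus_bounds[OF w, folded d_def N_def]
  have 1: "\<bar>w \<bullet> v\<bar> \<le> cmod v"
    using Cauchy_Schwarz_ineq2[of w v] mult_right_mono[of "cmod w" 1 "cmod v"] w by simp
  have 2: "\<bar>(1 - w) \<bullet> v\<bar> \<le> d * cmod v" 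
    using Cauchy_Schwarz_ineq2[of "1 - w" v] by (simp add: d_def)
  have "\<bar>DH0 w v\<bar> \<le> \<bar>2 * N * (w \<bullet> v) / d\<^sup>2\<bar> + \<bar>N * N * ((1 - w) \<bullet> v) / d^4\<bar>"
    unfolding DH0_def d_def[symmetric] N_def[symmetric] power2_eq_square[of N] by linarith
  also have "\<dots> \<le> 2 * N * cmod v / d\<^sup>2 + N * (2 * d) * (d * cmod v) / d^4"
    unfolding abs_mult abs_divide
    by (intro add_mono divide_mono mult_mono 1 2) (use pos in auto)
  also have "\<dots> = 4 * (N / d\<^sup>2) * cmod v"
    using pos by (simp add: power2_eq_square power4_eq_xxxx)
  finally show ?thesis by (simp add: d_def N_def)
qed

text \<open>The same trade of one \<open>N\<close> for \<open>2 * d\<close> in the last term of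
  \<open>DF0\<close> gives \<open>4 * N\<^sup>2 / d^4\<close>; with the 3 from the middle term this
  makes 7.\<close>

lemma abs_DF0_le:
  assumes w: "w \<in> ball 0 1"
  shows "\<bar>DF0 w v\<bar> \<le> (4 * ((1 - (cmod w)\<^sup>2) / (cmod (1 - w))\<^sup>2)
            + 7 * ((1 - (cmod w)\<^sup>2)\<^sup>2 / (cmod (1 - w))^4)) * cmod v"
proof -
  define d N where "d = cmod (1 - w)" and "N = 1 - (cmod w)\<^sup>2"
  note pos = cmod_one_minus_bounds[OF w, folded d_def N_def]
  have 1: "\<bar>w \<bullet> v\<bar> \<le> cmod v"
    using Cauchy_Schwarz_ineq2[of w v] mult_right_mono[of "cmod w" 1 "cmod v"] w by simp
  have 2: "\<bar>(1 - w) \<bullet> v\<bar> \<le> d * cmod v" 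
    using Cauchy_Schwarz_ineq2[of "1 - w" v] by (simp add: d_def)
  have "\<bar>DF0 w v\<bar> \<le> \<bar>DH0 w v\<bar> + \<bar>3 * N\<^sup>2 * (w \<bullet> v) / d^4\<bar> + \<bar>2 * (N\<^sup>2 * N) * ((1 - w) \<bullet> v) / d^6\<bar>"
  proof -
    have tri: "\<bar>a - b + c\<bar> \<le> \<bar>a\<bar> + \<bar>b\<bar> + \<bar>c\<bar>" for a b c :: real by arith
    have N3: "N ^ 3 = N\<^sup>2 * N" by (simp add: power2_eq_square power3_eq_cube)
    show ?thesis unfolding DF0_def d_def[symmetric] N_def[symmetric] N3 by (rule tri)
  qed
  also have "\<dots> \<le> 4 * (N / d\<^sup>2) * cmod v
      + 3 * N\<^sup>2 * cmod v / d^4 + 2 * (N\<^sup>2 * (2 * d)) * (d * cmod v) / d^6"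
    unfolding abs_mult abs_divide N_def d_def
    by (intro add_mono abs_DH0_le w divide_mono mult_mono 1[unfolded d_def] 2[unfolded d_def])
      (use pos in \<open>auto simp: d_def N_def\<close>)
  also have "\<dots> = (4 * (N / d\<^sup>2) + 7 * (N\<^sup>2 / d^4)) * cmod v"
  proof -
    have d6: "d^6 = d^4 * (d * d)" by (simp add: eval_nat_numeral)
    show ?thesis unfolding d6 using pos by (simp add: algebra_simps)
  qed
  finally show ?thesis by (simp add: d_def N_def)
qed

section \<open>Lipschitz bounds for the boundary operators\<close>

lemma circle_average_norm_le:
  fixes k :: "real \<Rightarrow> complex"
  assumes le: "\<And>\<theta>. cmod (k \<theta>) \<le> b \<theta>" and b: "(b has_integral 2 * pi * M) {0..2*pi}"
  shows "cmod (complex_of_real (1 / (2*pi)) * integral {0..2*pi} k) \<le> M"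
proof -
  have "0 \<le> b \<theta>" for \<theta> using le[of \<theta>] norm_ge_zero order_trans by blast
  then have M: "0 \<le> 2 * pi * M" using has_integral_nonneg[OF b] by blast
  have "cmod (integral {0..2*pi} k) \<le> 2 * pi * M"
  \<comment> \<open>If \<open>k\<close> is not integrable, its integral is 0 by convention and the
    bound follows from the sign of \<open>M\<close>.\<close>
  proof (cases "k integrable_on {0..2*pi}")
    case True
    have "cmod (integral {0..2*pi} k) \<le> integral {0..2*pi} b"
      by (rule Henstock_Kurzweil_Integration.integral_norm_bound_integral)
         (use True b le has_integral_integrable in auto)
    then show ?thesis using integral_unique[OF b] by simp
  qed (simp add: not_integrable_integral M)
  then show ?thesis by (simp add: norm_mult norm_divide field_simps)
qed

text \<open>The mean value inequality along the segment. Assumption \<open>loc\<close> lets the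
  boundary function be replaced, separately for each point and direction, by one with the same
  convolution up to a constant. This makes room for recentring \<open>f\<close> at a boundary point
  that moves with \<open>z\<close>.\<close>

lemma circle_conv_lipschitz:
  assumes K: "\<And>w. w \<in> ball 0 1 \<Longrightarrow> (K has_derivative DK w) (at w)"
    and DK: "continuous_on (ball 0 1 \<times> UNIV) (\<lambda>(w, v). DK w v)"
    and loc: "\<And>z v. z \<in> ball 0 1 \<Longrightarrow> \<exists>u' d. continuous_on {0..2*pi} (\<lambda>\<theta>. u' (cis \<theta>)) \<and>
      (\<forall>w\<in>ball 0 1. circle_conv K u w = circle_conv K u' w + d) \<and>
      cmod (complex_of_real (1 / (2 * pi)) * integral {0..2*pi}
        (\<lambda>\<theta>. complex_of_real (DK (z * cis (-\<theta>)) (v * cis (-\<theta>))) * u' (cis \<theta>))) \<le> M * cmod v"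
    and z: "z\<^sub>1 \<in> ball 0 1" "z\<^sub>2 \<in> ball 0 1"
  shows "cmod (circle_conv K u z\<^sub>1 - circle_conv K u z\<^sub>2) \<le> M * cmod (z\<^sub>1 - z\<^sub>2)"
proof -
  define v where "v = z\<^sub>1 - z\<^sub>2"
  let ?w = "\<lambda>t. z\<^sub>2 + t *\<^sub>R v"
  have seg: "?w t \<in> ball 0 1" if "t \<in> {0..1}" for t
  proof -
    have "?w t = (1 - t) *\<^sub>R z\<^sub>2 + t *\<^sub>R z\<^sub>1" by (simp add: v_def algebra_simps)
    then show ?thesis using that convexD_alt[OF convex_ball z(2,1)] by auto
  qed
  have "\<exists>D. ((\<lambda>t. circle_conv K u (?w t)) has_vector_derivative D) (at t within {0..1})
          \<and> cmod D \<le> M * cmod v" if t: "t \<in> {0..1}" for t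
  proof -
    obtain u' d where u': "continuous_on {0..2*pi} (\<lambda>\<theta>. u' (cis \<theta>))"
      and eq: "\<And>w. w\<in>ball 0 1 \<Longrightarrow> circle_conv K u w = circle_conv K u' w + d"
      and le: "cmod (complex_of_real (1 / (2 * pi)) * integral {0..2*pi}
        (\<lambda>\<theta>. complex_of_real (DK (?w t * cis (-\<theta>)) (v * cis (-\<theta>))) * u' (cis \<theta>))) \<le> M * cmod v"
      using loc[OF seg[OF t], of v] by blast
    define D where "D = complex_of_real (1 / (2 * pi)) * integral {0..2*pi}
        (\<lambda>\<theta>. complex_of_real (DK (?w t * cis (-\<theta>)) (v * cis (-\<theta>))) * u' (cis \<theta>))"
    have "((\<lambda>t. circle_conv K u' (?w t) + d) has_vector_derivative D) (at t within {0..1})"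
      unfolding D_def has_vector_derivative_add_const
      by (rule circle_conv_has_vector_derivative[OF K DK u' seg t])
    \<comment> \<open>Although \<open>u'\<close> and \<open>d\<close> were chosen for this
      \<open>t\<close>, the identity between the two convolutions holds on the whole disc, so the
      derivative carries over.\<close>
    then have "((\<lambda>t. circle_conv K u (?w t)) has_vector_derivative D) (at t within {0..1})"
      by (rule has_vector_derivative_transform[OF t, rotated]) (rule eq[OF seg])
    then show ?thesis using le[folded D_def] by blast
  qed
  then obtain D where D: "\<And>t. t \<in> {0..1} \<Longrightarrow>
      ((\<lambda>t. circle_conv K u (?w t)) has_vector_derivative D t) (at t within {0..1})"
    "\<And>t. t \<in> {0..1} \<Longrightarrow> cmod (D t) \<le> M * cmod v" by metis
  have "cmod (circle_conv K u (?w 1) - circle_conv K u (?w 0)) \<le> M * cmod v * norm (1 - 0 :: real)"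
  proof (rule differentiable_bound[OF convex_real_interval(5) D(1)[unfolded has_vector_derivative_def]])
    fix t :: real assume t: "t \<in> {0..1}"
    show "onorm (\<lambda>h. h *\<^sub>R D t) \<le> M * cmod v"
      by (rule onorm_le) (use mult_left_mono[OF D(2)[OF t] abs_ge_zero] in \<open>simp add: mult.commute\<close>)
  qed auto
  then show ?thesis by (simp add: v_def)
qed

text \<open>The gradient of \<open>H0\<close> is at most four times the Poisson kernel, whose mean
  is 1, so \<open>h\<close> itself serves as \<open>u'\<close>, with \<open>d = 0\<close>.\<close>

lemma H0_op_lipschitz:
  assumes h: "continuous_on {0..2*pi} (\<lambda>\<theta>. h (cis \<theta>))" and M: "\<And>\<theta>. cmod (h (cis \<theta>)) \<le> M"
    and z: "z\<^sub>1 \<in> ball 0 1" "z\<^sub>2 \<in> ball 0 1"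
  shows "cmod (H0_op h z\<^sub>1 - H0_op h z\<^sub>2) \<le> 4 * M * cmod (z\<^sub>1 - z\<^sub>2)"
  unfolding H0_op_def
proof (rule circle_conv_lipschitz[OF H0_has_derivative continuous_on_DH0 _ z])
  fix z v :: complex assume z: "z \<in> ball 0 1"
  let ?p = "\<lambda>\<theta>. z * cis (-\<theta>)"
  have "cmod (complex_of_real (1 / (2 * pi)) * integral {0..2*pi}
        (\<lambda>\<theta>. complex_of_real (DH0 (?p \<theta>) (v * cis (-\<theta>))) * h (cis \<theta>))) \<le> 4 * cmod v * M"
  proof (rule circle_average_norm_le)
    show "((\<lambda>\<theta>. 4 * cmod v * M * ((1 - (cmod z)\<^sup>2) / (cmod (1 - ?p \<theta>))\<^sup>2))
             has_integral 2 * pi * (4 * cmod v * M)) {0..2*pi}"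
      using has_integral_mult_right[OF circle_integral_Poisson(1)[OF z], of "4 * cmod v * M"]
      by (simp add: mult_ac)
    fix \<theta>
    have "\<bar>DH0 (?p \<theta>) (v * cis (-\<theta>))\<bar> * cmod (h (cis \<theta>))
        \<le> 4 * ((1 - (cmod z)\<^sup>2) / (cmod (1 - ?p \<theta>))\<^sup>2) * cmod v * M"
      using abs_DH0_le[OF rotate_in_disc[OF z], of "-\<theta>" "v * cis (-\<theta>)"]
        cmod_one_minus_bounds(2)[OF z]
      by (intro mult_mono M) (auto simp: norm_mult)
    then show "cmod (complex_of_real (DH0 (?p \<theta>) (v * cis (-\<theta>))) * h (cis \<theta>))
       \<le> 4 * cmod v * M * ((1 - (cmod z)\<^sup>2) / (cmod (1 - ?p \<theta>))\<^sup>2)"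
      by (simp add: norm_mult mult_ac)
  qed
  with h show "\<exists>u' d. continuous_on {0..2*pi} (\<lambda>\<theta>. u' (cis \<theta>)) \<and>
      (\<forall>w\<in>ball 0 1. circle_conv H0 h w = circle_conv H0 u' w + d) \<and>
      cmod (complex_of_real (1 / (2 * pi)) * integral {0..2*pi}
        (\<lambda>\<theta>. complex_of_real (DH0 (?p \<theta>) (v * cis (-\<theta>))) * u' (cis \<theta>))) \<le> 4 * M * cmod v"
    by (intro exI[of _ h] exI[of _ 0]) (simp add: mult_ac)
qed

lemma F0_op_diff_const:
  assumes f: "continuous_on {0..2*pi} (\<lambda>\<theta>. f (cis \<theta>))" and w: "w \<in> ball 0 1"
  shows "F0_op f w = F0_op (\<lambda>x. f x - c) w + c"
proof -
  let ?p = "\<lambda>\<theta>. w * cis (-\<theta>)"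
  have K_cont: "continuous_on (ball 0 1) F0"
    using F0_has_derivative by (meson continuous_at_imp_continuous_on has_derivative_continuous)
  have k: "continuous_on {0..2*pi} (\<lambda>\<theta>. complex_of_real (F0 (?p \<theta>)))"
    by (intro continuous_intros continuous_on_compose2[OF K_cont])
       (use rotate_in_disc[OF w, of "- _"] in \<open>auto simp: cis_conv_exp intro!: continuous_intros\<close>)
  have i: "(\<lambda>\<theta>. complex_of_real (F0 (?p \<theta>)) * f (cis \<theta>)) integrable_on {0..2*pi}"
    "(\<lambda>\<theta>. complex_of_real (F0 (?p \<theta>)) * c) integrable_on {0..2*pi}"
    by (intro integrable_continuous_interval continuous_on_mult f k continuous_on_const)+
  have "F0_op (\<lambda>x. f x - c) w = F0_op f w - F0_op (\<lambda>_. c) w"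
    unfolding F0_op_def circle_conv_def right_diff_distrib integral_diff[OF i] ..
  then show ?thesis by (simp add: F0_op_const[OF w])
qed

text \<open>Take \<phi> = \<open>Arg z\<close>, the radial projection of \<open>z\<close>. Going
  through \<open>z\<close>, the distance is at most \<open>|cis \<theta> - z| + (1 - |z|)\<close>,
  and both summands are at most \<open>|1 - z * cis (-\<theta>)|\<close>.\<close>

lemma cmod_cis_diff_le:
  assumes z: "z \<in> ball 0 1"
  obtains \<phi> where "\<And>\<theta>. cmod (cis \<theta> - cis \<phi>) \<le> 2 * cmod (1 - z * cis (-\<theta>))"
proof 
  fix \<theta>
  \<comment> \<open>This also covers \<open>z = 0\<close>, where the modulus cancels the
    conventional value of \<open>Arg\<close>.\<close>
  have z_eq: "z = cmod z * cis (Arg z)" 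
    by (metis rcis_cmod_Arg rcis_def)
  have "z - cis (Arg z) = complex_of_real (cmod z - 1) * cis (Arg z)"
    by (subst (1) z_eq) (simp add: algebra_simps)
  then have "cmod (z - cis (Arg z)) = \<bar>cmod z - 1\<bar>"
    by (simp only: norm_mult norm_of_real norm_cis mult_1_right)
  then have 1: "cmod (z - cis (Arg z)) = 1 - cmod z" using z by simp
  have "cis \<theta> - z = cis \<theta> * (1 - z * cis (-\<theta>))" by (simp add: algebra_simps cis_mult)
  then have 2: "cmod (cis \<theta> - z) = cmod (1 - z * cis (-\<theta>))" by (simp add: norm_mult)
  have 3: "1 - cmod z \<le> cmod (cis \<theta> - z)" using norm_triangle_ineq2[of "cis \<theta>" z] by simp
  have "cmod (cis \<theta> - cis (Arg z)) \<le> cmod (cis \<theta> - z) + cmod (z - cis (Arg z))"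
    using norm_triangle_ineq[of "cis \<theta> - z" "z - cis (Arg z)"] by simp
  with 1 2 3 show "cmod (cis \<theta> - cis (Arg z)) \<le> 2 * cmod (1 - z * cis (-\<theta>))" by simp
qed

text \<open>Recentring \<open>f\<close> at the radial projection of \<open>z\<close> bounds it by
  \<open>2 * L * d\<close>, and this extra \<open>d\<close> makes the gradient of \<open>F0\<close>
  integrable uniformly in \<open>z\<close>.\<close>

lemma F0_op_lipschitz:
  assumes f: "\<And>\<theta> \<phi>. cmod (f (cis \<theta>) - f (cis \<phi>)) \<le> L * cmod (cis \<theta> - cis \<phi>)"
    and z: "z\<^sub>1 \<in> ball 0 1" "z\<^sub>2 \<in> ball 0 1"
    and cont: "continuous_on {0..2*pi} (\<lambda>\<theta>. f (cis \<theta>))" and L: "0 \<le> L"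
  shows "cmod (F0_op f z\<^sub>1 - F0_op f z\<^sub>2) \<le> 37 * L * cmod (z\<^sub>1 - z\<^sub>2)"
  unfolding F0_op_def
proof (rule circle_conv_lipschitz[OF F0_has_derivative continuous_on_DF0 _ z])
  fix z v :: complex assume z: "z \<in> ball 0 1"
  let ?p = "\<lambda>\<theta>. z * cis (-\<theta>)" and ?N = "1 - (cmod z)\<^sup>2"
  let ?d = "\<lambda>\<theta>. cmod (1 - ?p \<theta>)"
  obtain \<phi> where \<phi>: "\<And>\<theta>. cmod (cis \<theta> - cis \<phi>) \<le> 2 * ?d \<theta>"
    using cmod_cis_diff_le[OF z] by blast
  define c where "c = f (cis \<phi>)"
  have fc: "cmod (f (cis \<theta>) - c) \<le> 2 * L * ?d \<theta>" for \<theta>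
    using f[of \<theta> \<phi>] mult_left_mono[OF \<phi>[of \<theta>] L] by (simp add: c_def)
  have "cmod (complex_of_real (1 / (2 * pi)) * integral {0..2*pi}
        (\<lambda>\<theta>. complex_of_real (DF0 (?p \<theta>) (v * cis (-\<theta>))) * (f (cis \<theta>) - c)))
      \<le> L * cmod v * (23 + 7 * (1 + (cmod z)\<^sup>2))"
  proof (rule circle_average_norm_le)
    have "((\<lambda>\<theta>. L * cmod v * (23 * (?N / (?d \<theta>)\<^sup>2) + 7 * (?N^3 / (?d \<theta>)^4)))
             has_integral L * cmod v * (23 * (2*pi) + 7 * (2*pi * (1 + (cmod z)\<^sup>2)))) {0..2*pi}"
      by (intro has_integral_mult_right has_integral_add circle_integral_Poisson z)
    then show "((\<lambda>\<theta>. L * cmod v * (23 * (?N / (?d \<theta>)\<^sup>2) + 7 * (?N^3 / (?d \<theta>)^4)))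
             has_integral 2*pi * (L * cmod v * (23 + 7 * (1 + (cmod z)\<^sup>2)))) {0..2*pi}"
      by (simp add: algebra_simps)
    fix \<theta>
    define d N where "d = ?d \<theta>" and "N = ?N"
    have pos: "0 < d" "0 < N" and d2: "d \<le> 2"
      using cmod_one_minus_bounds[OF rotate_in_disc[OF z, of "-\<theta>"]] cmod_one_minus_bounds(2)[OF z]
        norm_triangle_ineq4[of 1 "?p \<theta>"] z by (auto simp: d_def N_def norm_mult)
    \<comment> \<open>The kernel \<open>N\<^sup>2 / d^3\<close> is bounded by the two kernels whose
      circular means are known. With \<open>q = N / d\<close> the claim is
      \<open>2 * q\<^sup>2 \<le> q + q^3\<close>, that is
      \<open>0 \<le> q * (1 - q)\<^sup>2\<close>.\<close>
    have amgm: "2 * (N\<^sup>2 / d^3) \<le> N / d\<^sup>2 + N^3 / d^4"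
    proof -
      define q where "q = N / d"
      have "N / d\<^sup>2 = q / d" "N\<^sup>2 / d^3 = q\<^sup>2 / d" "N^3 / d^4 = q^3 / d"
        by (simp_all add: q_def eval_nat_numeral mult_ac)
      moreover have "0 \<le> q * (1 - q)\<^sup>2 / d" using pos by (simp add: q_def)
      then have "0 \<le> (q + q^3 - 2 * q\<^sup>2) / d"
        by (simp add: power2_eq_square power3_eq_cube algebra_simps)
      ultimately show ?thesis by (simp add: add_divide_distrib diff_divide_distrib)
    qed
    have "\<bar>DF0 (?p \<theta>) (v * cis (-\<theta>))\<bar> * cmod (f (cis \<theta>) - c)
        \<le> ((4 * (N / d\<^sup>2) + 7 * (N\<^sup>2 / d^4)) * cmod v) * (2 * L * d)"
      using abs_DF0_le[OF rotate_in_disc[OF z], of "-\<theta>" "v * cis (-\<theta>)"] fc[of \<theta>] pos L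
      by (intro mult_mono) (auto simp: norm_mult d_def N_def)
    also have "\<dots> = L * cmod v * (8 * (N / d\<^sup>2) * d + 14 * (N\<^sup>2 / d^3))"
    proof -
      have "N\<^sup>2 / d^3 = N\<^sup>2 / d^4 * d" using pos by (simp add: eval_nat_numeral)
      then show ?thesis by (simp only:) (simp add: algebra_simps)
    qed
    \<comment> \<open>Here \<open>d \<le> 2\<close> yields 16 Poisson kernels and
      \<open>amgm\<close> 7 more, which explains the 23.\<close>
    also have "\<dots> \<le> L * cmod v * (8 * (N / d\<^sup>2) * 2 + 7 * (N / d\<^sup>2 + N^3 / d^4))"
      using pos d2 L amgm by (intro mult_left_mono add_mono) auto
    finally show "cmod (complex_of_real (DF0 (?p \<theta>) (v * cis (-\<theta>))) * (f (cis \<theta>) - c))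
       \<le> L * cmod v * (23 * (?N / (?d \<theta>)\<^sup>2) + 7 * (?N^3 / (?d \<theta>)^4))"
      unfolding norm_mult d_def[symmetric] N_def[symmetric] by (simp add: algebra_simps)
  qed
  \<comment> \<open>The mean \<open>1 + |z|^2\<close> of the second kernel is at most 2, so the
    constant is 23 + 14 = 37.\<close>
  also have "\<dots> \<le> L * cmod v * (23 + 7 * (1 + 1))"
    using z L by (intro mult_left_mono) (auto simp: power_le_one)
  finally show "\<exists>u' d. continuous_on {0..2*pi} (\<lambda>\<theta>. u' (cis \<theta>)) \<and>
      (\<forall>w\<in>ball 0 1. circle_conv F0 f w = circle_conv F0 u' w + d) \<and>
      cmod (complex_of_real (1 / (2 * pi)) * integral {0..2*pi}
        (\<lambda>\<theta>. complex_of_real (DF0 (?p \<theta>) (v * cis (-\<theta>))) * u' (cis \<theta>))) \<le> 37 * L * cmod v"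
    using F0_op_diff_const[OF cont, of _ c] continuous_on_diff[OF cont continuous_on_const]
    unfolding F0_op_def
    by (intro exI[of _ "\<lambda>x. f x - c"] exI[of _ c] conjI ballI) (simp_all only: mult_ac, auto)
qed

subsection \<open>The Green potential\<close>

text \<open>Since \<open>X \<ge> 1 - a * b\<close> and \<open>Y \<ge> a - b\<close>, the sum
  \<open>X + Y\<close> is at least \<open>(1 + a) * (1 - b)\<close>. Dividing the identity for
  \<open>X\<^sup>2 - Y\<^sup>2\<close> by this gives the first bound on \<open>X - Y\<close>;
  exchanging \<open>a\<close> and \<open>b\<close> gives the second.\<close>

lemma disc_dist_bounds:
  fixes z \<zeta> :: complex
  assumes z: "z \<in> ball 0 1" and \<zeta>: "\<zeta> \<in> ball 0 1"
  defines "X \<equiv> cmod (1 - cnj \<zeta> * z)" and "Y \<equiv> cmod (z - \<zeta>)" and "a \<equiv> cmod z" and "b \<equiv> cmod \<zeta>"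
  shows "X\<^sup>2 - Y\<^sup>2 = (1 - a\<^sup>2) * (1 - b\<^sup>2)" "0 < X" "Y \<le> X"
    and "X - Y \<le> (1 - a) * (1 + b)" "X - Y \<le> (1 + a) * (1 - b)"
proof -
  have ab: "0 \<le> a" "a < 1" "0 \<le> b" "b < 1" using z \<zeta> by (auto simp: a_def b_def)
  show sq: "X\<^sup>2 - Y\<^sup>2 = (1 - a\<^sup>2) * (1 - b\<^sup>2)"
    unfolding X_def Y_def a_def b_def cmod_power2
    by (simp add: power2_eq_square algebra_simps)
  have X: "1 - a * b \<le> X"
    using norm_triangle_ineq2[of 1 "cnj \<zeta> * z"] by (simp add: X_def a_def b_def norm_mult mult.commute)
  have Y: "a - b \<le> Y" "b - a \<le> Y"
    using norm_triangle_ineq2[of z \<zeta>] norm_triangle_ineq2[of \<zeta> z]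
    by (simp_all add: Y_def a_def b_def norm_minus_commute)
  have "a * b < 1 * 1" using ab by (intro mult_strict_mono') auto
  then show X0: "0 < X" using X by simp
  have Y0: "0 \<le> Y" by (simp add: Y_def)
  have "0 \<le> (1 - a\<^sup>2) * (1 - b\<^sup>2)" using ab by (simp add: abs_square_le_1 power_le_one)
  then show XY: "Y \<le> X" using sq X0 power2_le_imp_le[of Y X] by simp
  have "(X - Y) * ((1 + a) * (1 - b)) \<le> (X - Y) * (X + Y)"
    using X Y XY by (intro mult_left_mono) (auto simp: algebra_simps)
  also have "\<dots> = (1 - a) * (1 + b) * ((1 + a) * (1 - b))"
    using sq by (simp add: power2_eq_square algebra_simps)
  finally show "X - Y \<le> (1 - a) * (1 + b)"
    using ab by (simp add: mult_le_cancel_right)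
  have "(X - Y) * ((1 + b) * (1 - a)) \<le> (X - Y) * (X + Y)"
    using X Y XY by (intro mult_left_mono) (auto simp: algebra_simps)
  also have "\<dots> = (1 + a) * (1 - b) * ((1 + b) * (1 - a))"
    using sq by (simp add: power2_eq_square algebra_simps)
  finally show "X - Y \<le> (1 + a) * (1 - b)"
    using ab by (simp add: mult_le_cancel_right)
qed

text \<open>Here \<open>t\<close> stands for \<open>X - Y\<close>. For \<open>b \<le> a\<close> the
  first bound on \<open>t\<close> gives an expression decreasing in \<open>a\<close>, for
  \<open>a < b\<close> the second gives an increasing one. Both are worst at \<open>a = b\<close>,
  where they equal \<open>(1 - b\<^sup>2) * (3 + b)\<close>.\<close>

lemma gradient_constant_bound:
  fixes a b t :: real
  assumes ab: "0 \<le> a" "a < 1" "0 \<le> b" "b < 1" 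
    and t: "t \<le> (1 - a) * (1 + b)" "t \<le> (1 + a) * (1 - b)"
  shows "2 * t + (1 - b\<^sup>2) + a * (1 - b\<^sup>2) \<le> 23/6"
proof -
  have *: "(1 - x\<^sup>2) * (3 + x) \<le> 23/6" if "0 \<le> x" for x :: real
  proof -
    \<comment> \<open>The square of \<open>6 * x - 1\<close> is chosen to absorb the linear term;
      what remains is 3 + 1/12, below 23/6.\<close>
    have "x \<le> 3 * x\<^sup>2 + 1/12"
      using zero_le_power2[of "6 * x - 1"] by (simp add: power2_eq_square algebra_simps)
    moreover have "(1 - x\<^sup>2) * (3 + x) = 3 + x - 3 * x\<^sup>2 - x^3"
      by (simp add: power2_eq_square power3_eq_cube algebra_simps)
    moreover have "0 \<le> x^3" using that by simp
    ultimately show ?thesis by linarith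
  qed
  show ?thesis
  proof (cases "b \<le> a")
    case True
    have "2 * t + (1 - b\<^sup>2) + a * (1 - b\<^sup>2) \<le> 2 * ((1 - a) * (1 + b)) + (1 - b\<^sup>2) + a * (1 - b\<^sup>2)"
      using t by simp
    also have "\<dots> = (1 + b) * (3 - b - a * (1 + b))" by (simp add: power2_eq_square algebra_simps)
    also have "\<dots> \<le> (1 + b) * (3 - b - b * (1 + b))"
      using True ab by (intro mult_left_mono diff_mono mult_right_mono) auto
    also have "\<dots> = (1 - b\<^sup>2) * (3 + b)" by (simp add: power2_eq_square algebra_simps)
    finally show ?thesis using *[OF ab(3)] by linarith
  next
    case False
    have "2 * t + (1 - b\<^sup>2) + a * (1 - b\<^sup>2) \<le> 2 * ((1 + a) * (1 - b)) + (1 - b\<^sup>2) + a * (1 - b\<^sup>2)"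
      using t by simp
    also have "\<dots> = (1 + a) * ((1 - b) * (3 + b))" by (simp add: power2_eq_square algebra_simps)
    also have "\<dots> \<le> (1 + b) * ((1 - b) * (3 + b))"
      using False ab by (intro mult_right_mono) auto
    also have "\<dots> = (1 - b\<^sup>2) * (3 + b)" by (simp add: power2_eq_square algebra_simps)
    finally show ?thesis using *[OF ab(3)] by linarith
  qed
qed

text \<open>Splitting the logarithm allows the pieces to be differentiated separately. At
  \<open>z = \<zeta>\<close> the factor 0 removes all logarithms on both sides.\<close>

lemma Green_eq:
  assumes z: "z \<in> ball 0 1" and \<zeta>: "\<zeta> \<in> ball 0 1"
  shows "Green z \<zeta> = (cmod (z - \<zeta>))\<^sup>2 * ln ((cmod (1 - cnj \<zeta> * z))\<^sup>2)
      - (cmod (z - \<zeta>))\<^sup>2 * ln ((cmod (z - \<zeta>))\<^sup>2) - (1 - (cmod z)\<^sup>2) * (1 - (cmod \<zeta>)\<^sup>2)"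
  using disc_dist_bounds(2)[OF assms]
  by (cases "z = \<zeta>") (simp_all add: Green_def norm_divide power_divide ln_div right_diff_distrib)

text \<open>At \<open>w = 0\<close> the junk value of \<open>ln 0\<close> is multiplied by 0 in both the function and its derivative.\<close>

lemma power2_ln_has_derivative:
  "((\<lambda>w. (cmod w)\<^sup>2 * ln ((cmod w)\<^sup>2)) has_derivative
     (\<lambda>v. 2 * (w \<bullet> v) * (ln ((cmod w)\<^sup>2) + 1))) (at w)"
proof (cases "w = 0")
  case True
  have lim: "((\<lambda>r::real. r * ln (r\<^sup>2)) \<longlongrightarrow> 0) (at_right 0)" 
  proof (rule tendsto_rabs_zero_cancel, rule tendsto_sandwich[where f = "\<lambda>_. 0" and h = "\<lambda>r. 4 * sqrt r"])
    show "((\<lambda>r::real. 4 * sqrt r) \<longlongrightarrow> 0) (at_right 0)"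
      by (auto intro!: tendsto_eq_intros)
    have "\<bar>r * ln (r\<^sup>2)\<bar> \<le> 4 * sqrt r" if "0 < r" "r < 1" for r :: real
    proof -
      \<comment> \<open>Applying \<open>ln x \<le> x - 1\<close> to \<open>1 / sqrt r\<close> rather
        than to \<open>1 / r\<close> leaves a factor \<open>sqrt r\<close>, which tends to
        0.\<close>
      have "ln (1 / sqrt r) \<le> 1 / sqrt r - 1" using that by (intro ln_le_minus_one) simp
      then have "- ln r \<le> 2 / sqrt r" using that by (simp add: ln_div ln_sqrt)
      then have "r * - ln r \<le> r * (2 / sqrt r)" using that by (intro mult_left_mono) auto
      also have "\<dots> = 2 * sqrt r" using that real_div_sqrt[of r] by (metis less_imp_le mult.commute times_divide_eq_right)
      finally have "- (r * ln r) \<le> 2 * sqrt r" by simp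
      moreover have "r * ln r \<le> 0" using that by (simp add: mult_le_0_iff)
      ultimately show ?thesis using that by (simp add: ln_realpow)
    qed
    then show "\<forall>\<^sub>F r in at_right 0. \<bar>r * ln (r\<^sup>2)\<bar> \<le> 4 * sqrt r"
      unfolding eventually_at_right_field by (intro exI[of _ 1]) auto
  qed auto
  have "((\<lambda>w. (cmod w)\<^sup>2 * ln ((cmod w)\<^sup>2)) has_derivative (\<lambda>v. 0)) (at 0)"
    unfolding has_derivative_at
  proof (intro conjI)
    \<comment> \<open>In the difference quotient one factor \<open>norm h\<close> cancels; what
      remains is \<open>|r * ln (r\<^sup>2)|\<close> at \<open>r = norm h\<close>.\<close>
    have "filterlim cmod (at_right 0) (at 0)"
      unfolding filterlim_at by (auto simp: eventually_at_filter intro!: tendsto_eq_intros)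
    from filterlim_compose[OF lim this]
    show "(\<lambda>h. norm ((cmod (0 + h))\<^sup>2 * ln ((cmod (0 + h))\<^sup>2) - (cmod 0)\<^sup>2 * ln ((cmod 0)\<^sup>2) - 0) / norm h)
           \<midarrow>0\<rightarrow> 0"
      by (rule Lim_transform_eventually[OF tendsto_rabs_zero])
         (auto simp: eventually_at_filter power2_eq_square abs_mult)
  qed simp
  then show ?thesis using True by simp
next
  case False
  then have pos: "0 < w \<bullet> w" by simp
  show ?thesis
    unfolding power2_norm_eq_inner
    apply (rule derivative_eq_intros pos refl)+
    using pos by (auto simp: fun_eq_iff inner_commute field_simps)
qed

lemma power2_norm_has_derivative:
  fixes g :: "'a::real_normed_vector \<Rightarrow> 'b::real_inner"
  assumes "(g has_derivative g') (at x)"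
  shows "((\<lambda>x. (norm (g x))\<^sup>2) has_derivative (\<lambda>v. 2 * (g x \<bullet> g' v))) (at x)"
  unfolding power2_norm_eq_inner
  by (rule has_derivative_eq_rhs[OF has_derivative_inner[OF assms assms]])
     (simp add: fun_eq_iff inner_commute)

text \<open>The diagonal \<open>z = \<zeta>\<close> is included, because
  \<open>|w|^2 * ln (|w|^2)\<close> is differentiable at 0 too. The split form is differentiated,
  and the result passes to \<open>Green\<close> because the two agree on the open disc.\<close>

lemma Green_has_derivative:
  assumes z: "z \<in> ball 0 1" and \<zeta>: "\<zeta> \<in> ball 0 1"
  defines "X \<equiv> cmod (1 - cnj \<zeta> * z)" and "Y \<equiv> cmod (z - \<zeta>)"
  shows "((\<lambda>z. Green z \<zeta>) has_derivative
     (\<lambda>v. 2 * ((z - \<zeta>) \<bullet> v) * (ln (X\<^sup>2) - ln (Y\<^sup>2))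
        - 2 * Y\<^sup>2 * ((1 - cnj \<zeta> * z) \<bullet> (cnj \<zeta> * v)) / X\<^sup>2 - 2 * ((z - \<zeta>) \<bullet> v)
        + 2 * (z \<bullet> v) * (1 - (cmod \<zeta>)\<^sup>2))) (at z)"
proof -
  have X: "0 < X\<^sup>2" using disc_dist_bounds(2)[OF z \<zeta>] by (simp add: X_def)
  have p: "((\<lambda>z. z - \<zeta>) has_derivative (\<lambda>v. v)) (at z)"
    and q: "((\<lambda>z. 1 - cnj \<zeta> * z) has_derivative (\<lambda>v. - (cnj \<zeta> * v))) (at z)"
    by (auto intro!: derivative_eq_intros)
  have 1: "((\<lambda>z. (cmod (z - \<zeta>))\<^sup>2 * ln ((cmod (z - \<zeta>))\<^sup>2)) has_derivative
       (\<lambda>v. 2 * ((z - \<zeta>) \<bullet> v) * (ln (Y\<^sup>2) + 1))) (at z)"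
    using has_derivative_compose[OF p power2_ln_has_derivative] by (simp only: Y_def)
  have 2: "((\<lambda>z. (cmod (z - \<zeta>))\<^sup>2 * ln ((cmod (1 - cnj \<zeta> * z))\<^sup>2)) has_derivative
       (\<lambda>v. Y\<^sup>2 * (2 * ((1 - cnj \<zeta> * z) \<bullet> - (cnj \<zeta> * v)) * inverse (X\<^sup>2))
          + 2 * ((z - \<zeta>) \<bullet> v) * ln (X\<^sup>2))) (at z)"
    unfolding X_def Y_def
    by (intro has_derivative_mult has_derivative_ln power2_norm_has_derivative p q X[unfolded X_def])
  have 3: "((\<lambda>z. (1 - (cmod z)\<^sup>2) * (1 - (cmod \<zeta>)\<^sup>2)) has_derivative
      (\<lambda>v. (0 - 2 * (z \<bullet> v)) * (1 - (cmod \<zeta>)\<^sup>2))) (at z)"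
    by (intro has_derivative_mult_left has_derivative_diff has_derivative_const
        power2_norm_has_derivative has_derivative_ident)
  have "((\<lambda>z. (cmod (z - \<zeta>))\<^sup>2 * ln ((cmod (1 - cnj \<zeta> * z))\<^sup>2)
      - (cmod (z - \<zeta>))\<^sup>2 * ln ((cmod (z - \<zeta>))\<^sup>2) - (1 - (cmod z)\<^sup>2) * (1 - (cmod \<zeta>)\<^sup>2)) has_derivative
     (\<lambda>v. 2 * ((z - \<zeta>) \<bullet> v) * (ln (X\<^sup>2) - ln (Y\<^sup>2))
        - 2 * Y\<^sup>2 * ((1 - cnj \<zeta> * z) \<bullet> (cnj \<zeta> * v)) / X\<^sup>2 - 2 * ((z - \<zeta>) \<bullet> v)
        + 2 * (z \<bullet> v) * (1 - (cmod \<zeta>)\<^sup>2))) (at z)"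
  proof (rule has_derivative_eq_rhs[OF has_derivative_diff[OF has_derivative_diff[OF 2 1] 3]], rule ext)
    fix v
    define s t where "s = (z - \<zeta>) \<bullet> v" and "t = (1 - cnj \<zeta> * z) \<bullet> (cnj \<zeta> * v)"
    show "Y\<^sup>2 * (2 * ((1 - cnj \<zeta> * z) \<bullet> - (cnj \<zeta> * v)) * inverse (X\<^sup>2))
          + 2 * ((z - \<zeta>) \<bullet> v) * ln (X\<^sup>2) - 2 * ((z - \<zeta>) \<bullet> v) * (ln (Y\<^sup>2) + 1)
          - (0 - 2 * (z \<bullet> v)) * (1 - (cmod \<zeta>)\<^sup>2)
      = 2 * ((z - \<zeta>) \<bullet> v) * (ln (X\<^sup>2) - ln (Y\<^sup>2))
        - 2 * Y\<^sup>2 * ((1 - cnj \<zeta> * z) \<bullet> (cnj \<zeta> * v)) / X\<^sup>2 - 2 * ((z - \<zeta>) \<bullet> v)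
        + 2 * (z \<bullet> v) * (1 - (cmod \<zeta>)\<^sup>2)"
      unfolding inner_minus_right s_def[symmetric] t_def[symmetric] divide_inverse
      by (simp only: algebra_simps)
  qed
  then show ?thesis
    by (rule has_derivative_transform_within_open[OF _ open_ball z]) (rule Green_eq[OF _ \<zeta>, symmetric])
qed

text \<open>The logarithmic term, the two middle terms together and the last term are bounded
  separately. Their sum is twice the quantity of \<open>gradient_constant_bound\<close>, times
  \<open>cmod v\<close>.\<close>

lemma Green_gradient_le:
  assumes z: "z \<in> ball 0 1" and \<zeta>: "\<zeta> \<in> ball 0 1"
  defines "X \<equiv> cmod (1 - cnj \<zeta> * z)" and "Y \<equiv> cmod (z - \<zeta>)"
  shows "\<bar>2 * ((z - \<zeta>) \<bullet> v) * (ln (X\<^sup>2) - ln (Y\<^sup>2))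
        - 2 * Y\<^sup>2 * ((1 - cnj \<zeta> * z) \<bullet> (cnj \<zeta> * v)) / X\<^sup>2 - 2 * ((z - \<zeta>) \<bullet> v)
        + 2 * (z \<bullet> v) * (1 - (cmod \<zeta>)\<^sup>2)\<bar> \<le> 23/3 * cmod v"
proof -
  define b where "b = cmod \<zeta>"
  note bounds = disc_dist_bounds[OF z \<zeta>, folded X_def Y_def b_def]
  have X0: "0 < X" and XY: "Y \<le> X" and Y0: "0 \<le> Y" using bounds by (auto simp: Y_def)
  have b1: "0 \<le> 1 - b\<^sup>2" using \<zeta> by (simp add: b_def power_le_one)
  \<comment> \<open>The bound rests on \<open>Y * ln (X / Y) \<le> X - Y\<close>. For
    \<open>Y = 0\<close> the inner product vanishes and removes the value of
    \<open>ln 0\<close>.\<close>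
  have log: "\<bar>2 * ((z - \<zeta>) \<bullet> v) * (ln (X\<^sup>2) - ln (Y\<^sup>2))\<bar> \<le> 2 * (2 * (X - Y)) * cmod v"
  proof (cases "Y = 0")
    case True
    then show ?thesis using X0 by (simp add: Y_def)
  next
    case False
    then have Y: "0 < Y" using Y0 by simp
    have "0 \<le> ln (X / Y)" using XY Y by simp
    moreover have "ln (X / Y) \<le> X / Y - 1" using X0 Y by (intro ln_le_minus_one) simp
    then have "Y * ln (X / Y) \<le> X - Y" using Y by (simp add: field_simps)
    moreover have "ln (X\<^sup>2) - ln (Y\<^sup>2) = 2 * ln (X / Y)"
      using X0 Y by (simp add: ln_div ln_realpow)
    moreover have "\<bar>(z - \<zeta>) \<bullet> v\<bar> \<le> Y * cmod v"
      using Cauchy_Schwarz_ineq2[of "z - \<zeta>" v] by (simp add: Y_def)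
    then have "\<bar>(z - \<zeta>) \<bullet> v\<bar> * ln (X / Y) \<le> Y * cmod v * ln (X / Y)"
      using calculation(1) by (rule mult_right_mono)
    moreover have "(Y * ln (X / Y)) * cmod v \<le> (X - Y) * cmod v"
      using calculation(2) by (rule mult_right_mono) simp
    ultimately have "\<bar>(z - \<zeta>) \<bullet> v\<bar> * ln (X / Y) \<le> (X - Y) * cmod v"
      and "\<bar>2 * ((z - \<zeta>) \<bullet> v) * (ln (X\<^sup>2) - ln (Y\<^sup>2))\<bar> = 4 * (\<bar>(z - \<zeta>) \<bullet> v\<bar> * ln (X / Y))"
      by (simp_all add: abs_mult mult_ac)
    then show ?thesis by linarith
  qed
  \<comment> \<open>The two terms are combined before estimating: writing \<open>Y\<^sup>2\<close>
    and \<open>X\<^sup>2\<close> as products with conjugates, all but a factor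
    \<open>1 - b\<^sup>2\<close> cancels. Separate bounds would lose that factor.\<close>
  have mid: "\<bar>2 * Y\<^sup>2 * ((1 - cnj \<zeta> * z) \<bullet> (cnj \<zeta> * v)) / X\<^sup>2 + 2 * ((z - \<zeta>) \<bullet> v)\<bar>
      \<le> 2 * (1 - b\<^sup>2) * cmod v"
  proof -
    let ?q = "(z - \<zeta>) * cnj (1 - cnj \<zeta> * z)"
    have "Y\<^sup>2 * ((1 - cnj \<zeta> * z) \<bullet> (cnj \<zeta> * v)) + X\<^sup>2 * ((z - \<zeta>) \<bullet> v)
        = (1 - b\<^sup>2) * (((z - \<zeta>) * (1 - cnj \<zeta> * z)) \<bullet> v)"
      unfolding X_def Y_def b_def cmod_power2 inner_complex_def
      by (simp add: power2_eq_square algebra_simps)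
    then have eq: "Y\<^sup>2 * ((1 - cnj \<zeta> * z) \<bullet> (cnj \<zeta> * v)) / X\<^sup>2 + ((z - \<zeta>) \<bullet> v)
        = (1 - b\<^sup>2) * (((z - \<zeta>) * (1 - cnj \<zeta> * z)) \<bullet> v) / X\<^sup>2"
      using X0 by (simp add: field_simps)
    have "\<bar>((z - \<zeta>) * (1 - cnj \<zeta> * z)) \<bullet> v\<bar> \<le> Y * X * cmod v"
      using Cauchy_Schwarz_ineq2[of "(z - \<zeta>) * (1 - cnj \<zeta> * z)" v] by (simp add: X_def Y_def norm_mult)
    also have "\<dots> \<le> X * X * cmod v" using XY X0 by (intro mult_right_mono) auto
    finally have "(1 - b\<^sup>2) * \<bar>((z - \<zeta>) * (1 - cnj \<zeta> * z)) \<bullet> v\<bar> / X\<^sup>2 \<le> (1 - b\<^sup>2) * (X * X * cmod v) / X\<^sup>2"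
      using b1 by (intro divide_right_mono mult_left_mono) auto
    also have "\<dots> = (1 - b\<^sup>2) * cmod v" using X0 by (simp add: power2_eq_square)
    finally have "\<bar>Y\<^sup>2 * ((1 - cnj \<zeta> * z) \<bullet> (cnj \<zeta> * v)) / X\<^sup>2 + ((z - \<zeta>) \<bullet> v)\<bar> \<le> (1 - b\<^sup>2) * cmod v"
      unfolding eq using b1 by (simp add: abs_mult)
    then show ?thesis by linarith
  qed
  have last: "\<bar>2 * (z \<bullet> v) * (1 - b\<^sup>2)\<bar> \<le> 2 * (cmod z * cmod v) * (1 - b\<^sup>2)"
    unfolding abs_mult using b1 Cauchy_Schwarz_ineq2[of z v] by (intro mult_mono) auto
  have "2 * (X - Y) + (1 - b\<^sup>2) + cmod z * (1 - b\<^sup>2) \<le> 23/6"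
    using gradient_constant_bound[OF _ _ _ _ bounds(4,5)] z \<zeta> by (simp add: b_def)
  then have "2 * (2 * (X - Y) + (1 - b\<^sup>2) + cmod z * (1 - b\<^sup>2)) * cmod v \<le> 2 * (23/6) * cmod v"
    by (intro mult_right_mono mult_left_mono) auto
  then have fin: "2 * (2 * (X - Y)) * cmod v + 2 * (1 - b\<^sup>2) * cmod v + 2 * (cmod z * cmod v) * (1 - b\<^sup>2) \<le> 23/3 * cmod v"
    by (simp add: algebra_simps)
  show ?thesis unfolding b_def[symmetric] using log mid last fin by linarith
qed

text \<open>The mean value inequality on the convex disc; the segment may pass through \<zeta>,
  since \<open>Green\<close> is differentiable there as well.\<close>

lemma Green_lipschitz:
  assumes z: "z\<^sub>1 \<in> ball 0 1" "z\<^sub>2 \<in> ball 0 1" and \<zeta>: "\<zeta> \<in> ball 0 1"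
  shows "\<bar>Green z\<^sub>1 \<zeta> - Green z\<^sub>2 \<zeta>\<bar> \<le> 23/3 * cmod (z\<^sub>1 - z\<^sub>2)"
  unfolding real_norm_def[symmetric]
  by (rule differentiable_bound[OF convex_ball has_derivative_at_withinI[OF Green_has_derivative[OF _ \<zeta>]] _ z])
     (assumption, rule onorm_le, rule Green_gradient_le[OF _ \<zeta>, folded real_norm_def])

text \<open>With \<open>m = X\<^sup>2 - Y\<^sup>2\<close>, the logarithmic term lies between 0 and
  \<open>m\<close>, so \<open>Green\<close> lies between \<open>-m\<close> and 0, and
  \<open>m \<le> 1\<close>. This bound serves the integrability of the potential.\<close>

lemma abs_Green_le:
  assumes z: "z \<in> ball 0 1" and \<zeta>: "\<zeta> \<in> ball 0 1"
  shows "\<bar>Green z \<zeta>\<bar> \<le> 1"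
proof -
  define X Y where "X = cmod (1 - cnj \<zeta> * z)" and "Y = cmod (z - \<zeta>)"
  define m where "m = (1 - (cmod z)\<^sup>2) * (1 - (cmod \<zeta>)\<^sup>2)"
  note bounds = disc_dist_bounds[OF z \<zeta>, folded X_def Y_def m_def]
  have "m \<le> 1 * 1" unfolding m_def using z \<zeta>
    by (intro mult_mono) (auto simp: power_le_one)
  moreover have "0 \<le> m" unfolding m_def using z \<zeta> by (auto simp: power_le_one)
  moreover have "0 \<le> Y\<^sup>2 * ln ((X / Y)\<^sup>2) \<and> Y\<^sup>2 * ln ((X / Y)\<^sup>2) \<le> X\<^sup>2 - Y\<^sup>2"
  proof (cases "Y = 0")
    case False
    then have Y: "0 < Y" by (simp add: Y_def)
    have "1 \<le> (X / Y)\<^sup>2" using bounds(2,3) Y by simp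
    then have "0 \<le> ln ((X / Y)\<^sup>2)" by (rule ln_ge_zero)
    moreover have "ln ((X / Y)\<^sup>2) \<le> (X / Y)\<^sup>2 - 1" using bounds(2) Y by (intro ln_le_minus_one) simp
    then have "Y\<^sup>2 * ln ((X / Y)\<^sup>2) \<le> Y\<^sup>2 * ((X / Y)\<^sup>2 - 1)" by (rule mult_left_mono) simp
    then have "Y\<^sup>2 * ln ((X / Y)\<^sup>2) \<le> X\<^sup>2 - Y\<^sup>2" using Y by (simp add: power_divide right_diff_distrib)
    ultimately show ?thesis by simp
  qed simp
  ultimately show ?thesis unfolding Green_def norm_divide X_def[symmetric] Y_def[symmetric] m_def[symmetric]
    using bounds(1) by linarith
qed

section \<open>Integration of the kernel over the disc\<close>

lemma disc_integral_norm_le: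
  assumes u: "\<And>\<zeta>. \<zeta> \<in> ball 0 1 \<Longrightarrow> cmod (u \<zeta>) \<le> M"
  shows "cmod (disc_integral u) \<le> M"
proof -
  have M: "0 \<le> M" using u[of 0] norm_ge_zero[of "u 0"] by (simp del: norm_ge_zero)
  have area: "measure lborel (ball (0::complex) 1) = pi"
    using content_ball[of 1 "0::complex"] by (simp add: unit_ball_vol_2)
  have "cmod (LINT \<zeta>:ball 0 1|lborel. u \<zeta>) \<le> M * pi"
  \<comment> \<open>As on the circle, the integral of a function that is not integrable is 0, and
    \<open>M\<close> is nonnegative because it bounds \<open>u\<close> at the origin.\<close>
  proof (cases "set_integrable lborel (ball 0 1) u")
    case True
    have "cmod (LINT \<zeta>:ball 0 1|lborel. u \<zeta>) \<le> (LINT \<zeta>:ball 0 1|lborel. cmod (u \<zeta>))"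
      using True by (rule set_integral_norm_bound)
    also have "\<dots> \<le> (LINT \<zeta>:ball (0::complex) 1|lborel. M)"
    proof (rule set_integral_mono)
      show "set_integrable lborel (ball (0::complex) 1) (\<lambda>_. M)"
        unfolding set_integrable_def
        by (intro integrable_scaleR_left integrable_real_indicator) (use emeasure_bounded_finite[OF bounded_ball] in auto)
    qed (use u set_integrable_norm[OF True] in auto)
    also have "\<dots> = M * pi" by (simp add: set_lebesgue_integral_def area)
    finally show ?thesis .
  next
    case False
    then show ?thesis
      using M by (simp add: set_integrable_def set_lebesgue_integral_def not_integrable_integral_eq)
  qed
  then show ?thesis by (simp add: disc_integral_def norm_divide field_simps)
qed

lemma Green_op_lipschitz:
  assumes g: "continuous_on (ball 0 1) g" and M: "\<And>\<zeta>. \<zeta> \<in> ball 0 1 \<Longrightarrow> cmod (g \<zeta>) \<le> M"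
    and z: "z\<^sub>1 \<in> ball 0 1" "z\<^sub>2 \<in> ball 0 1"
  shows "cmod (Green_op g z\<^sub>1 - Green_op g z\<^sub>2) \<le> 23/3 * M * cmod (z\<^sub>1 - z\<^sub>2)"
proof -
  \<comment> \<open>Integrability for each \<open>z\<close> allows the difference of two potentials
    to be written as one integral, to which the pointwise Lipschitz bound applies.\<close>
  have int: "set_integrable lborel (ball 0 1) (\<lambda>\<zeta>. complex_of_real (Green z \<zeta>) * g \<zeta>)"
    if z: "z \<in> ball 0 1" for z
    unfolding set_integrable_def
  proof (rule integrableI_bounded_set[where A = "ball 0 1" and B = M])
    \<comment> \<open>Continuity of \<open>g\<close> is given on the disc, so the indicator is
      attached to \<open>g\<close>; the formula for \<open>Green\<close> is measurable on the whole
      plane.\<close>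
    have "(\<lambda>\<zeta>. indicator (ball 0 1) \<zeta> *\<^sub>R g \<zeta>) \<in> borel_measurable borel"
      using g by (simp add: borel_measurable_continuous_on_indicator)
    moreover have "(\<lambda>\<zeta>. Green z \<zeta>) \<in> borel_measurable borel"
    proof -
      have [measurable]: "cnj \<in> borel_measurable borel"
        by (intro borel_measurable_continuous_onI continuous_intros)
      show ?thesis unfolding Green_def by measurable
    qed
    ultimately have "(\<lambda>\<zeta>. complex_of_real (Green z \<zeta>) * (indicator (ball 0 1) \<zeta> *\<^sub>R g \<zeta>)) \<in> borel_measurable borel"
      by measurable
    then show "(\<lambda>\<zeta>. indicator (ball 0 1) \<zeta> *\<^sub>R (complex_of_real (Green z \<zeta>) * g \<zeta>)) \<in> borel_measurable lborel"
      by (simp add: mult_ac scaleR_conv_of_real)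
    show "emeasure lborel (ball (0::complex) 1) < \<infinity>" by (rule emeasure_bounded_finite[OF bounded_ball])
    have "\<bar>Green z \<zeta>\<bar> * cmod (g \<zeta>) \<le> 1 * M" if "\<zeta> \<in> ball 0 1" for \<zeta>
      by (intro mult_mono abs_Green_le M z that) auto
    then show "AE \<zeta>\<in>ball 0 1 in lborel. norm (indicator (ball 0 1) \<zeta> *\<^sub>R (complex_of_real (Green z \<zeta>) * g \<zeta>)) \<le> M"
      by (auto simp: norm_mult)
  qed (auto split: split_indicator)
  have "Green_op g z\<^sub>1 - Green_op g z\<^sub>2
      = disc_integral (\<lambda>\<zeta>. complex_of_real (Green z\<^sub>1 \<zeta>) * g \<zeta> - complex_of_real (Green z\<^sub>2 \<zeta>) * g \<zeta>)"
    unfolding Green_op_def disc_integral_def 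
    by (simp add: set_integral_diff(2)[OF int[OF z(1)] int[OF z(2)]] right_diff_distrib)
  also have "cmod \<dots> \<le> 23/3 * cmod (z\<^sub>1 - z\<^sub>2) * M"
  proof (rule disc_integral_norm_le)
    fix \<zeta> :: complex assume \<zeta>: "\<zeta> \<in> ball 0 1"
    have "\<bar>Green z\<^sub>1 \<zeta> - Green z\<^sub>2 \<zeta>\<bar> * cmod (g \<zeta>) \<le> 23/3 * cmod (z\<^sub>1 - z\<^sub>2) * M"
      by (intro mult_mono Green_lipschitz M z \<zeta>) auto
    then show "cmod (complex_of_real (Green z\<^sub>1 \<zeta>) * g \<zeta> - complex_of_real (Green z\<^sub>2 \<zeta>) * g \<zeta>) \<le> 23/3 * cmod (z\<^sub>1 - z\<^sub>2) * M"
      by (simp add: norm_mult flip: left_diff_distrib of_real_diff)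
  qed
  finally show ?thesis by (simp add: mult_ac)
qed

subsection \<open>The two-sided bound\<close>

lemma integral_cis_minus: "((\<lambda>\<theta>. cis (-\<theta>)) has_integral 0) {0..2*pi}"
proof -
  have "((\<lambda>\<theta>. \<i> * cis (-\<theta>)) has_vector_derivative cis (-\<theta>)) (at \<theta> within {0..2*pi})" for \<theta>
    using rotate_has_vector_derivative[of \<i> \<theta>] by (simp flip: mult.assoc)
  from fundamental_theorem_of_calculus[OF _ this] show ?thesis
    by (simp add: cis_cnj[symmetric])
qed

text \<open>The Lipschitz condition controls only differences of \<open>f\<close>, so
  \<open>f (cis 0)\<close> is subtracted; constants integrate to 0 against
  \<open>cis (-\<theta>)\<close>. The circle has diameter 2, hence the integrand is at most
  \<open>6 * L + M\<close>, and the prefactor is half that of a mean.\<close>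

lemma boundary_coefficient_le:
  assumes f: "\<And>\<theta> \<phi>. cmod (f (cis \<theta>) - f (cis \<phi>)) \<le> L * cmod (cis \<theta> - cis \<phi>)" and L: "0 \<le> L"
    and cont: "continuous_on {0..2*pi} (\<lambda>\<theta>. f (cis \<theta>))" "continuous_on {0..2*pi} (\<lambda>\<theta>. h (cis \<theta>))"
    and h: "\<And>\<theta>. cmod (h (cis \<theta>)) \<le> M"
  shows "cmod (complex_of_real (1 / (4 * pi)) * integral {0..2*pi}
           (\<lambda>\<theta>. cis (-\<theta>) * (3 * f (cis \<theta>) + h (cis \<theta>)))) \<le> 3 * L + M / 2"
proof -
  let ?k = "\<lambda>\<theta>. cis (-\<theta>) * (3 * (f (cis \<theta>) - f (cis 0)) + h (cis \<theta>))"
  have cis: "continuous_on {0..2*pi} (\<lambda>\<theta>. cis (-\<theta>))"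
    by (simp add: cis_conv_exp) (intro continuous_intros)
  have "?k integrable_on {0..2*pi}"
    by (intro integrable_continuous_interval continuous_intros cis cont)
  then have "((\<lambda>\<theta>. ?k \<theta> + cis (-\<theta>) * (3 * f (cis 0))) has_integral (integral {0..2*pi} ?k + 0 * (3 * f (cis 0)))) {0..2*pi}"
    by (intro has_integral_add integrable_integral has_integral_mult_left integral_cis_minus)
  moreover have "?k \<theta> + cis (-\<theta>) * (3 * f (cis 0)) = cis (-\<theta>) * (3 * f (cis \<theta>) + h (cis \<theta>))" for \<theta>
    by (simp add: algebra_simps)
  ultimately have eq: "integral {0..2*pi} (\<lambda>\<theta>. cis (-\<theta>) * (3 * f (cis \<theta>) + h (cis \<theta>))) = integral {0..2*pi} ?k"
    by (simp only: integral_unique mult_zero_left add_0_right)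
  have "cmod (complex_of_real (1 / (2*pi)) * integral {0..2*pi} ?k) \<le> 6 * L + M"
  proof (rule circle_average_norm_le)
    show "((\<lambda>_. 6 * L + M) has_integral 2 * pi * (6 * L + M)) {0..2*pi}"
      using has_integral_const_real[of "6 * L + M" 0 "2*pi"] by simp
    fix \<theta>
    have "cmod (cis \<theta> - cis 0) \<le> 2" using norm_triangle_ineq4[of "cis \<theta>" "cis 0"] by simp
    then have "cmod (f (cis \<theta>) - f (cis 0)) \<le> L * 2"
      using f[of \<theta> 0] mult_left_mono[OF _ L] order_trans by blast
    then have "cmod (3 * (f (cis \<theta>) - f (cis 0)) + h (cis \<theta>)) \<le> 3 * (L * 2) + M"
      by (intro norm_triangle_le add_mono h) (simp only: norm_mult, simp)
    then show "cmod (?k \<theta>) \<le> 6 * L + M" by (simp add: norm_mult)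
  qed
  then show ?thesis unfolding eq by (simp add: norm_mult norm_divide field_simps)
qed

text \<open>By \<open>ln x \<le> x - 1\<close> the weight is nonpositive and its modulus is at most
  \<open>- ln (r\<^sup>2)\<close>; the factor \<open>r\<close> then gives
  \<open>-2 * r * ln r \<le> 2 * (1 - r)\<close>. At the origin the factor \<open>r\<close> makes
  the product 0.\<close>

lemma disc_coefficient_le:
  assumes M: "\<And>\<zeta>. \<zeta> \<in> ball 0 1 \<Longrightarrow> cmod (g \<zeta>) \<le> M"
  shows "cmod (disc_integral (\<lambda>\<zeta>. cnj \<zeta> * complex_of_real (ln ((cmod \<zeta>)\<^sup>2) + 1 - (cmod \<zeta>)\<^sup>2) * g \<zeta>)) \<le> 2 * M"
proof (rule disc_integral_norm_le)
  fix \<zeta> :: complex assume \<zeta>: "\<zeta> \<in> ball 0 1"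
  define r where "r = cmod \<zeta>"
  have r: "0 \<le> r" "r < 1" using \<zeta> by (auto simp: r_def)
  have "r * \<bar>ln (r\<^sup>2) + 1 - r\<^sup>2\<bar> \<le> 2"
  proof (cases "r = 0")
    case False
    with r have r0: "0 < r" by simp
    have "ln (1 / r) \<le> 1 / r - 1" using r0 by (intro ln_le_minus_one) simp
    then have "r * - ln r \<le> r * (1 / r - 1)" using r0 by (intro mult_left_mono) (auto simp: ln_div)
    also have "\<dots> = 1 - r" using r0 by (simp add: right_diff_distrib)
    finally have 1: "- (r * ln r) \<le> 1 - r" by simp
    have "ln (r\<^sup>2) \<le> r\<^sup>2 - 1" using r0 by (intro ln_le_minus_one) simp
    moreover have "r\<^sup>2 \<le> 1" using r by (simp add: power_le_one)
    ultimately have "\<bar>ln (r\<^sup>2) + 1 - r\<^sup>2\<bar> \<le> - ln (r\<^sup>2)" by linarith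
    then have "r * \<bar>ln (r\<^sup>2) + 1 - r\<^sup>2\<bar> \<le> r * - ln (r\<^sup>2)" using r0 by (intro mult_left_mono) auto
    also have "\<dots> = 2 * - (r * ln r)" using r0 by (simp add: ln_realpow)
    finally show ?thesis using 1 r by linarith
  qed simp
  then have "r * \<bar>ln (r\<^sup>2) + 1 - r\<^sup>2\<bar> * cmod (g \<zeta>) \<le> 2 * M"
    by (intro mult_mono M \<zeta>) auto
  then show "cmod (cnj \<zeta> * complex_of_real (ln ((cmod \<zeta>)\<^sup>2) + 1 - (cmod \<zeta>)\<^sup>2) * g \<zeta>) \<le> 2 * M"
    by (simp only: norm_mult norm_of_real complex_mod_cnj r_def)
qed

theorem theorem1p2:
  fixes \<Phi> f h g :: "complex \<Rightarrow> complex" and L P A B Q :: real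
  assumes \<Phi>: "\<And>z. z \<in> ball 0 1 \<Longrightarrow> \<Phi> z = F0_op f z + H0_op h z - Green_op g z"
    and h: "continuous_on (sphere 0 1) h"
    and g: "continuous_on (cball 0 1) g"
    and f: "\<And>\<theta> \<phi>. cmod (f (cis \<theta>) - f (cis \<phi>)) \<le> L * cmod (cis \<theta> - cis \<phi>)"
    and P: "P = 220/3 * L + 4 * (SUP z\<in>sphere 0 1. cmod (h z))
                + 23/3 * (SUP z\<in>ball 0 1. cmod (g z))"
    and A: "A = (cmod (complex_of_real (1 / (4 * pi)) * integral {0..2*pi}
                         (\<lambda>\<theta>. cis (-\<theta>) * (3 * f (cis \<theta>) + h (cis \<theta>)))
                       - disc_integral (\<lambda>\<zeta>. cnj \<zeta>
                           * complex_of_real (ln ((cmod \<zeta>)\<^sup>2) + 1 - (cmod \<zeta>)\<^sup>2) * g \<zeta>)))\<^sup>2"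
    and B: "B = (cmod (complex_of_real (1 / (4 * pi)) * integral {0..2*pi}
                         (\<lambda>\<theta>. cis \<theta> * (3 * f (cis \<theta>) + h (cis \<theta>)))
                       - disc_integral (\<lambda>\<zeta>. \<zeta>
                           * complex_of_real (ln ((cmod \<zeta>)\<^sup>2) + 1 - (cmod \<zeta>)\<^sup>2) * g \<zeta>)))\<^sup>2"
    and Q: "Q = A - B"
  shows "\<forall>z\<^sub>1\<in>ball 0 1. \<forall>z\<^sub>2\<in>ball 0 1.
           P * (Q / P\<^sup>2 - 2) * cmod (z\<^sub>1 - z\<^sub>2) \<le> cmod (\<Phi> z\<^sub>1 - \<Phi> z\<^sub>2)
           \<and> cmod (\<Phi> z\<^sub>1 - \<Phi> z\<^sub>2) \<le> P * cmod (z\<^sub>1 - z\<^sub>2)"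
proof (intro ballI conjI)
  define Mh Mg where "Mh = (SUP z\<in>sphere 0 1. cmod (h z))" and "Mg = (SUP z\<in>ball 0 1. cmod (g z))"
  \<comment> \<open>The antipodal points \<open>cis 0\<close> and \<open>cis pi\<close> have
    positive distance, so the Lipschitz condition forces the sign.\<close>
  have L: "0 \<le> L"
    using order_trans[OF norm_ge_zero f[of 0 pi]] by (simp add: zero_le_mult_iff)
  have "bdd_above ((\<lambda>z. cmod (h z)) ` sphere 0 1)"
    by (intro bounded_imp_bdd_above compact_imp_bounded compact_continuous_image
        continuous_intros h compact_sphere)
  then have hM: "cmod (h (cis \<theta>)) \<le> Mh" for \<theta>
    unfolding Mh_def by (intro cSUP_upper) auto
  \<comment> \<open>Compactness of the closed disc makes the supremum over the open disc a genuine
    upper bound.\<close>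
  have "bdd_above ((\<lambda>z. cmod (g z)) ` cball 0 1)"
    by (intro bounded_imp_bdd_above compact_imp_bounded compact_continuous_image
        continuous_intros g compact_cball)
  then have "bdd_above ((\<lambda>z. cmod (g z)) ` ball 0 1)"
    by (rule bdd_above_mono) auto
  then have gM: "cmod (g z) \<le> Mg" if "z \<in> ball 0 1" for z
    unfolding Mg_def using that by (intro cSUP_upper) auto
  have M0: "0 \<le> Mh" "0 \<le> Mg"
    using order_trans[OF norm_ge_zero hM] order_trans[OF norm_ge_zero gM[of 0]] by auto
  have P_eq: "P = 220/3 * L + 4 * Mh + 23/3 * Mg" by (simp add: P Mh_def Mg_def)
  have f_cont: "continuous_on {0..2*pi} (\<lambda>\<theta>. f (cis \<theta>))"
  proof -
    have "L-lipschitz_on (sphere 0 1) f"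
    proof (rule lipschitz_onI[OF _ L])
      fix x y :: complex assume "x \<in> sphere 0 1" "y \<in> sphere 0 1"
      then have "x = cis (Arg x)" "y = cis (Arg y)" using rcis_cmod_Arg[of x] rcis_cmod_Arg[of y]
        by (simp_all add: rcis_def)
      then show "dist (f x) (f y) \<le> L * dist x y" using f[of "Arg x" "Arg y"] by (simp add: dist_norm)
    qed
    then show ?thesis
      by (rule continuous_on_compose2[OF lipschitz_on_continuous_on])
         (auto simp: cis_conv_exp norm_exp_eq_Re intro!: continuous_intros)
  qed
  have h_cont: "continuous_on {0..2*pi} (\<lambda>\<theta>. h (cis \<theta>))"
    by (rule continuous_on_compose2[OF h])
       (auto simp: cis_conv_exp norm_exp_eq_Re intro!: continuous_intros)
  fix z\<^sub>1 z\<^sub>2 :: complex assume z: "z\<^sub>1 \<in> ball 0 1" "z\<^sub>2 \<in> ball 0 1"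
  have "\<Phi> z\<^sub>1 - \<Phi> z\<^sub>2 = (F0_op f z\<^sub>1 - F0_op f z\<^sub>2) + (H0_op h z\<^sub>1 - H0_op h z\<^sub>2)
      - (Green_op g z\<^sub>1 - Green_op g z\<^sub>2)"
    unfolding \<Phi>[OF z(1)] \<Phi>[OF z(2)] by simp
  also have "cmod \<dots> \<le> (37 * L * cmod (z\<^sub>1 - z\<^sub>2) + 4 * Mh * cmod (z\<^sub>1 - z\<^sub>2)) + 23/3 * Mg * cmod (z\<^sub>1 - z\<^sub>2)"
    by (intro norm_triangle_le_diff norm_triangle_le add_mono F0_op_lipschitz H0_op_lipschitz
        Green_op_lipschitz continuous_on_subset[OF g] f f_cont h_cont hM gM z L ball_subset_cball)
  also have "\<dots> = (37 * L + 4 * Mh + 23/3 * Mg) * cmod (z\<^sub>1 - z\<^sub>2)" by (simp add: algebra_simps)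
  \<comment> \<open>Only the coefficient of \<open>L\<close> changes here, from 37 to 220/3.\<close>
  also have "\<dots> \<le> P * cmod (z\<^sub>1 - z\<^sub>2)" using L by (intro mult_right_mono) (auto simp: P_eq)
  finally show "cmod (\<Phi> z\<^sub>1 - \<Phi> z\<^sub>2) \<le> P * cmod (z\<^sub>1 - z\<^sub>2)" .
  have "0 \<le> P" using L M0 by (simp add: P_eq)
  \<comment> \<open>The coefficients 3, 1/2 and 2 of \<open>L\<close>, \<open>Mh\<close> and
    \<open>Mg\<close> are below those in \<open>P\<close>.\<close>
  have "A \<le> P\<^sup>2"
    unfolding A
  proof (rule power_mono)
    have "cmod (complex_of_real (1 / (4 * pi)) * integral {0..2*pi}
           (\<lambda>\<theta>. cis (-\<theta>) * (3 * f (cis \<theta>) + h (cis \<theta>)))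
         - disc_integral (\<lambda>\<zeta>. cnj \<zeta> * complex_of_real (ln ((cmod \<zeta>)\<^sup>2) + 1 - (cmod \<zeta>)\<^sup>2) * g \<zeta>))
       \<le> (3 * L + Mh / 2) + 2 * Mg"
      by (intro norm_triangle_le_diff add_mono boundary_coefficient_le disc_coefficient_le
          f L f_cont h_cont hM gM)
    also have "\<dots> \<le> P" using L M0 by (simp add: P_eq)
    finally show "cmod (complex_of_real (1 / (4 * pi)) * integral {0..2*pi}
           (\<lambda>\<theta>. cis (-\<theta>) * (3 * f (cis \<theta>) + h (cis \<theta>)))
         - disc_integral (\<lambda>\<zeta>. cnj \<zeta> * complex_of_real (ln ((cmod \<zeta>)\<^sup>2) + 1 - (cmod \<zeta>)\<^sup>2) * g \<zeta>)) \<le> P" .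
  qed simp
  moreover have "0 \<le> B" by (simp add: B)
  ultimately have "Q \<le> 2 * P\<^sup>2" using zero_le_power2[of P] unfolding Q by linarith
  \<comment> \<open>For \<open>P = 0\<close> the product is 0 whatever the quotient; otherwise
    \<open>Q \<le> 2 * P\<^sup>2\<close> decides the sign.\<close>
  then have "P * (Q / P\<^sup>2 - 2) \<le> 0"
    using \<open>0 \<le> P\<close> by (cases "P = 0") (auto simp: mult_le_0_iff divide_simps)
  then have "P * (Q / P\<^sup>2 - 2) * cmod (z\<^sub>1 - z\<^sub>2) \<le> 0" by (rule mult_nonpos_nonneg) simp
  then show "P * (Q / P\<^sup>2 - 2) * cmod (z\<^sub>1 - z\<^sub>2) \<le> cmod (\<Phi> z\<^sub>1 - \<Phi> z\<^sub>2)"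
    using norm_ge_zero order_trans by blast
qed

end
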